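(* Let $X$ be a locally compact Hausdorff space with Borel $\sigma$-algebra $\mathscr{B}$, let $E$ be a monotone complete and normal partially ordered vector space, and let $\pi:\mathrm{C}_{\mathrm c}(X)\to E$ be a positive operator. Then there exists a unique measure $\mu:\mathscr{B}\to\overline{E^+}$ such that: (1) for every relatively compact open subset $U$ of $X$, the restriction $\mu_U$ of $\mu$ to the Borel $\sigma$-algebra $\mathscr{B}_U$ of $U$ is a regular Borel measure on $U$; (2) $\mu$ is weakly inner regular at all Borel sets; (3) $\pi(f)=\int_X^{\mathrm{o}} f\,\mathrm{d}\mu$ for all $f\in\mathrm{C}_{\mathrm c}(X)$. This measure $\mu$ is a quasi-regular Borel measure. If $\widetilde\mu$ is a regular Borel measure on $X$ such that $\pi(f)=\int_X^{\mathrm{o}} f\,\mathrm{d}\widetilde\mu$ for all $f\in\mathrm{C}_{\mathrm c}(X)$, then $\widetilde\mu\geq\mu$ (setwise on $\mathscr{B}$). Furthermore, $\widetilde\mu$ and $\mu$ agree at all open subsets of $X$; at all compact subsets of $X$; at all Borel sets with finite $\widetilde\mu$-measure; and at all Borel sets with infinite $\mu$-measure.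
   Context: Ordered spaces. Vector spaces are real; operators and functionals are linear. A partially ordered vector space $E$ has a proper positive cone $E^+$, which need not be generating. $E$ is monotone complete if every increasing net in $E$ that is bounded above has a supremum in $E$. An operator between partially ordered vector spaces is positive if it maps the positive cone into the positive cone. A positive functional $x'$ on $E$ is order continuous if $(x_\lambda,x')\downarrow 0$ for every net $x_\lambda\downarrow0$ in $E$ (decreasing with infimum $0$). $E_{\mathrm{oc}}^{\sim}$ is the space of differences of positive order continuous functionals, and $(E_{\mathrm{oc}}^{\sim})^+$ is the set of positive order continuous functionals. $E$ is normal if, for $x\in E$, one has $(x,x')\ge0$ for all $x'\in(E_{\mathrm{oc}}^{\sim})^+$ if and only if $x\in E^+$. Extended space. $\overline{E}=E\cup\{\infty\}$ (disjoint union), ordered by the order of $E$ and $x\le\infty$ for all $x\in\overline E$; $\overline{E^+}=E^+\cup\{\infty\}$; $\infty+x=x+\infty=\infty$; $r\cdot\infty=\infty$ for real $r>0$, $0\cdot\infty=0$. Elements of $E$ are called finite. Measures. A (positive $\overline E$-valued) measure on $\mathscr{B}$ is a map $\mu:\mathscr{B}\to\overline{E^+}$ with $\mu(\emptyset)=0$ and $\mu(\bigcup_n\Delta_n)=\bigvee_{N=1}^\infty\sum_{n=1}^N\mu(\Delta_n)$ in $\overline E$ for pairwise disjoint sequences $(\Delta_n)$ in $\mathscr{B}$. Order integral. For a measurable $\varphi=\sum_{i=1}^n r_i\chi_{\Delta_i}\ge 0$ taking finitely many finite values ($r_i\in\mathbb{R}^+$, $\Delta_i\in\mathscr{B}$),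 $\int_X^{\mathrm o}\varphi\,\mathrm d\mu=\sum_i r_i\mu(\Delta_i)\in\overline{E^+}$. For measurable $f:X\to[0,\infty]$, $\int_X^{\mathrm o}f\,\mathrm d\mu=\bigvee_n\int_X^{\mathrm o}\varphi_n\,\mathrm d\mu$ in $\overline{E}$, for any sequence of such elementary functions $\varphi_n\uparrow f$ pointwise (independent of the choice). A measurable $f:X\to\mathbb{R}$ is integrable if $\int_X^{\mathrm o}|f|\,\mathrm d\mu$ is finite, and then $\int_X^{\mathrm o}f\,\mathrm d\mu=\int_X^{\mathrm o}f^+\,\mathrm d\mu-\int_X^{\mathrm o}f^-\,\mathrm d\mu$. Regularity. $\mu$ is a Borel measure if $\mu(K)\in E$ for all compact $K\subseteq X$; inner regular at $\Delta\in\mathscr{B}$ if $\mu(\Delta)=\bigvee\{\mu(K):K\text{ compact},K\subseteq\Delta\}$ in $\overline E$; weakly inner regular at $\Delta$ if $\mu(\Delta)=\bigvee\{\mu(\Delta\cap K):K\text{ compact}\}$ in $\overline E$; outer regular at $\Delta$ if $\mu(\Delta)=\bigwedge\{\mu(V):V\text{ open},\Delta\subseteq V\}$ in $\overline E$. A regular Borel measure is a Borel measure that is inner regular at all open sets and outer regular at all Borel sets. A quasi-regular Borel measure is a Borel measure that is inner regular at all open sets and weakly inner regular at all Borel sets. For $U\subseteq X$ open, $U$ is itself a locally compact Hausdorff space, with Borel $\sigma$-algebra $\mathscr{B}_U=\{\Delta\in\mathscr{B}:\Delta\subseteq U\}$. An open set is relatively compact if its closure in $X$ is compact. $\mathrm{C}_{\mathrm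 c}(X)$ is the space of real-valued continuous functions on $X$ with compact support, with the pointwise order. *)

theory Defs
  imports "HOL-Analysis.Analysis" "HOL-Library.Lub_Glb"
begin

section \<open>Nets in partially ordered vector spaces\<close>

definition directed_index :: "'i set \<Rightarrow> ('i \<Rightarrow> 'i \<Rightarrow> bool) \<Rightarrow> bool" where
  "directed_index I le \<longleftrightarrow>
     I \<noteq> {} \<and> reflp_on I le \<and> transp_on I le \<and> (\<forall>i\<in>I. \<forall>j\<in>I. \<exists>k\<in>I. le i k \<and> le j k)"

definition increasing_net :: "'i set \<Rightarrow> ('i \<Rightarrow> 'i \<Rightarrow> bool) \<Rightarrow> ('i \<Rightarrow> 'b::order) \<Rightarrow> bool" where
  "increasing_net I le x \<longleftrightarrow> directed_index I le \<and> monotone_on I le (\<le>) x"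

definition decreasing_net :: "'i set \<Rightarrow> ('i \<Rightarrow> 'i \<Rightarrow> bool) \<Rightarrow> ('i \<Rightarrow> 'b::order) \<Rightarrow> bool" where
  "decreasing_net I le x \<longleftrightarrow> directed_index I le \<and> monotone_on I le (\<ge>) x"

definition net_decreases_to ::
  "'i set \<Rightarrow> ('i \<Rightarrow> 'i \<Rightarrow> bool) \<Rightarrow> ('i \<Rightarrow> 'b::order) \<Rightarrow> 'b \<Rightarrow> bool" where
  "net_decreases_to I le x a \<longleftrightarrow> decreasing_net I le x \<and> isGlb UNIV (x ` I) a"

text \<open>
  HOL cannot quantify over all index types inside a definition. In \<open>monotone_complete\<close> and
  \<open>order_continuous\<close> the nets are therefore indexed by directed preordered subsets of the space
  itself. Nothing is lost, since a monotone net may be re-indexed by its range; see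
  \<open>monotone_complete_net\<close> and \<open>order_continuous_net\<close>. The space itself is represented by a type
  of class \<^class>\<open>ordered_real_vector\<close>, whose order is the one given by a proper cone.
\<close>

definition monotone_complete :: "'e::ordered_real_vector itself \<Rightarrow> bool" where
  "monotone_complete TYPE('e) \<longleftrightarrow>
     (\<forall>(I :: 'e set) le (x :: 'e \<Rightarrow> 'e).
        increasing_net I le x \<and> (\<exists>u. isUb UNIV (x ` I) u) \<longrightarrow> (\<exists>s. isLub UNIV (x ` I) s))"

definition order_continuous :: "('e::ordered_real_vector \<Rightarrow> real) \<Rightarrow> bool" where
  "order_continuous x' \<longleftrightarrow>
     (\<forall>(I :: 'e set) le (x :: 'e \<Rightarrow> 'e).
        net_decreases_to I le x 0 \<longrightarrow> net_decreases_to I le (\<lambda>i. x' (x i)) 0)"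

definition positive_functional :: "('e::ordered_real_vector \<Rightarrow> real) \<Rightarrow> bool" where
  "positive_functional x' \<longleftrightarrow> linear x' \<and> (\<forall>x\<ge>0. 0 \<le> x' x)"

definition positive_oc_functionals :: "('e::ordered_real_vector \<Rightarrow> real) set" where
  "positive_oc_functionals = {x'. positive_functional x' \<and> order_continuous x'}"

definition normal_ordered_space :: "'e::ordered_real_vector itself \<Rightarrow> bool" where
  "normal_ordered_space TYPE('e) \<longleftrightarrow>
     (\<forall>x :: 'e. (\<forall>x'\<in>positive_oc_functionals. 0 \<le> x' x) \<longleftrightarrow> 0 \<le> x)"

lemma monotone_complete_net:
  fixes x :: "'i \<Rightarrow> 'e::ordered_real_vector"
  assumes "monotone_complete TYPE('e)" "increasing_net I le x" "\<exists>u. isUb UNIV (x ` I) u"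
  shows "\<exists>s. isLub UNIV (x ` I) s"
proof -
  have "increasing_net (x ` I) (\<le>) (\<lambda>y. y)"
    using assms(2) unfolding increasing_net_def directed_index_def monotone_on_def
    by (auto intro!: reflp_onI transp_onI) meson
  then show ?thesis
    using assms(1,3) unfolding monotone_complete_def by (metis image_ident)
qed

lemma order_continuous_net:
  fixes x :: "'i \<Rightarrow> 'e::ordered_real_vector"
  assumes "positive_functional x'" "order_continuous x'" "net_decreases_to I le x 0"
  shows "net_decreases_to I le (\<lambda>i. x' (x i)) 0"
proof -
  have mono: "x' a \<le> x' b" if "a \<le> b" for a b
  proof -
    have "0 \<le> x' (b - a)"
      using assms(1) that by (auto simp: positive_functional_def)
    moreover have "x' (b - a) = x' b - x' a"
      using assms(1) by (simp add: positive_functional_def linear_diff)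
    ultimately show ?thesis by simp
  qed
  have "decreasing_net (x ` I) (\<ge>) (\<lambda>y. y)"
    using assms(3)
    unfolding net_decreases_to_def decreasing_net_def directed_index_def monotone_on_def
    by (auto intro!: reflp_onI transp_onI) meson
  then have "net_decreases_to (x ` I) (\<ge>) (\<lambda>y. y) 0"
    using assms(3) by (auto simp: net_decreases_to_def)
  then have "net_decreases_to (x ` I) (\<ge>) (\<lambda>y. x' y) 0"
    using assms(2) by (auto simp: order_continuous_def)
  then show ?thesis
    using assms(3) mono
    by (auto simp: net_decreases_to_def decreasing_net_def monotone_on_def image_image)
qed

section \<open>The extended space\<close>

datatype 'e ext_space = Fin (fin_part: 'e) | Infty

instantiation ext_space :: (order) order
begin

definition less_eq_ext_space :: "'a ext_space \<Rightarrow> 'a ext_space \<Rightarrow> bool" where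
  "x \<le> y \<longleftrightarrow> (case y of Infty \<Rightarrow> True | Fin b \<Rightarrow> (case x of Infty \<Rightarrow> False | Fin a \<Rightarrow> a \<le> b))"

definition less_ext_space :: "'a ext_space \<Rightarrow> 'a ext_space \<Rightarrow> bool" where
  "(x :: 'a ext_space) < y \<longleftrightarrow> x \<le> y \<and> \<not> y \<le> x"

instance
  by standard (auto simp: less_eq_ext_space_def less_ext_space_def split: ext_space.splits)

end

instantiation ext_space :: (comm_monoid_add) comm_monoid_add
begin

definition zero_ext_space :: "'a ext_space" where
  "0 = Fin 0"

definition plus_ext_space :: "'a ext_space \<Rightarrow> 'a ext_space \<Rightarrow> 'a ext_space" where
  "x + y = (case (x, y) of (Fin a, Fin b) \<Rightarrow> Fin (a + b) | _ \<Rightarrow> Infty)"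

instance
  by standard (auto simp: zero_ext_space_def plus_ext_space_def ac_simps split: ext_space.splits)

end

text \<open>Only meaningful for \<open>r \<ge> 0\<close>; note that \<open>0 \<cdot> \<infinity> = 0\<close>.\<close>

definition ext_scale :: "real \<Rightarrow> 'e::real_vector ext_space \<Rightarrow> 'e ext_space" where
  "ext_scale r x = (case x of Fin a \<Rightarrow> Fin (r *\<^sub>R a) | Infty \<Rightarrow> (if r = 0 then 0 else Infty))"

definition is_finite :: "'e ext_space \<Rightarrow> bool" where
  "is_finite x \<longleftrightarrow> x \<noteq> Infty"

section \<open>Measures and the order integral\<close>

text \<open>
  A measure with values in the extended space is a function on sets of which only the values on
  the \<open>\<sigma>\<close>-algebra \<^term>\<open>sets M\<close> matter; the library measure \<^term>\<open>M\<close> serves only as a carrier of the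
  underlying set and \<open>\<sigma>\<close>-algebra. In particular, restricting such a measure to a smaller
  \<open>\<sigma>\<close>-algebra of subsets does not change the function.
\<close>

definition ext_measure ::
  "'a measure \<Rightarrow> ('a set \<Rightarrow> 'e::ordered_real_vector ext_space) \<Rightarrow> bool" where
  "ext_measure M \<mu> \<longleftrightarrow>
     (\<forall>\<Delta>\<in>sets M. 0 \<le> \<mu> \<Delta>) \<and>
     \<mu> {} = 0 \<and>
     (\<forall>D :: nat \<Rightarrow> 'a set. range D \<subseteq> sets M \<and> disjoint_family D \<longrightarrow>
        isLub UNIV (range (\<lambda>N. \<Sum>n\<le>N. \<mu> (D n))) (\<mu> (\<Union>n. D n)))"

definition elementary_function :: "'a measure \<Rightarrow> ('a \<Rightarrow> real) \<Rightarrow> bool" where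
  "elementary_function M \<phi> \<longleftrightarrow> simple_function M \<phi> \<and> (\<forall>x\<in>space M. 0 \<le> \<phi> x)"

text \<open>As for \<^const>\<open>simple_integral\<close>, the representation by level sets is used.\<close>

definition elementary_integral ::
  "'a measure \<Rightarrow> ('a set \<Rightarrow> 'e::ordered_real_vector ext_space) \<Rightarrow> ('a \<Rightarrow> real) \<Rightarrow> 'e ext_space" where
  "elementary_integral M \<mu> \<phi> = (\<Sum>r\<in>\<phi> ` space M. ext_scale r (\<mu> (\<phi> -` {r} \<inter> space M)))"

definition elementary_approx :: "'a measure \<Rightarrow> (nat \<Rightarrow> 'a \<Rightarrow> real) \<Rightarrow> ('a \<Rightarrow> ennreal) \<Rightarrow> bool" where
  "elementary_approx M \<phi> f \<longleftrightarrow>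
     (\<forall>n. elementary_function M (\<phi> n)) \<and>
     (\<forall>x\<in>space M. incseq (\<lambda>n. \<phi> n x) \<and> (\<lambda>n. ennreal (\<phi> n x)) \<longlonglongrightarrow> f x)"

text \<open>
  Applied to measurable \<open>f\<close> only. The supremum does not depend on the approximating sequence when
  the value space is monotone complete and \<open>\<mu>\<close> is a measure.
\<close>

definition order_nn_integral ::
  "'a measure \<Rightarrow> ('a set \<Rightarrow> 'e::ordered_real_vector ext_space) \<Rightarrow> ('a \<Rightarrow> ennreal) \<Rightarrow> 'e ext_space" where
  "order_nn_integral M \<mu> f =
     (THE s. \<exists>\<phi>. elementary_approx M \<phi> f \<and> isLub UNIV (range (\<lambda>n. elementary_integral M \<mu> (\<phi> n))) s)"

definition order_integrable ::
  "'a measure \<Rightarrow> ('a set \<Rightarrow> 'e::ordered_real_vector ext_space) \<Rightarrow> ('a \<Rightarrow> real) \<Rightarrow> bool" where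
  "order_integrable M \<mu> f \<longleftrightarrow>
     f \<in> borel_measurable M \<and> is_finite (order_nn_integral M \<mu> (\<lambda>x. ennreal \<bar>f x\<bar>))"

definition order_integral ::
  "'a measure \<Rightarrow> ('a set \<Rightarrow> 'e::ordered_real_vector ext_space) \<Rightarrow> ('a \<Rightarrow> real) \<Rightarrow> 'e" where
  "order_integral M \<mu> f =
     fin_part (order_nn_integral M \<mu> (\<lambda>x. ennreal (max (f x) 0)))
     - fin_part (order_nn_integral M \<mu> (\<lambda>x. ennreal (max (- f x) 0)))"

section \<open>Regularity of Borel measures\<close>

definition borel_of :: "'a topology \<Rightarrow> 'a measure" where
  "borel_of X = sigma (topspace X) {U. openin X U}"

lemma sets_borel_of: "sets (borel_of X) = sigma_sets (topspace X) {U. openin X U}"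
  unfolding borel_of_def by (rule sets_measure_of) (auto dest: openin_subset)

lemma space_borel_of: "space (borel_of X) = topspace X"
  unfolding borel_of_def by (rule space_measure_of) (auto dest: openin_subset)

lemma sets_borel_of_open_subtopology:
  assumes "openin X U"
  shows "sets (borel_of (subtopology X U)) = {\<Delta> \<in> sets (borel_of X). \<Delta> \<subseteq> U}"
proof -
  have U: "U \<subseteq> topspace X"
    using assms by (rule openin_subset)
  have top: "topspace (subtopology X U) = U"
    using U by auto
  have opens: "{V. openin (subtopology X U) V} = (\<inter>) U ` {V. openin X V}"
    by (auto simp: openin_subtopology)
  have "sets (borel_of (subtopology X U)) = (\<inter>) U ` sets (borel_of X)"
    unfolding sets_borel_of top opens
    using sigma_sets_Int[of U "topspace X" "{V. openin X V}"] assms U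
    by (simp add: sigma_sets.Basic Int_commute)
  also have "\<dots> = {\<Delta> \<in> sets (borel_of X). \<Delta> \<subseteq> U}"
  proof -
    have "U \<in> sets (borel_of X)"
      using assms by (simp add: sets_borel_of sigma_sets.Basic)
    then show ?thesis by auto
  qed
  finally show ?thesis .
qed

definition borel_ext_measure ::
  "'a topology \<Rightarrow> ('a set \<Rightarrow> 'e::ordered_real_vector ext_space) \<Rightarrow> bool" where
  "borel_ext_measure X \<mu> \<longleftrightarrow>
     ext_measure (borel_of X) \<mu> \<and> (\<forall>K. compactin X K \<longrightarrow> is_finite (\<mu> K))"

definition inner_regular_at ::
  "'a topology \<Rightarrow> ('a set \<Rightarrow> 'e::ordered_real_vector ext_space) \<Rightarrow> 'a set \<Rightarrow> bool" where
  "inner_regular_at X \<mu> \<Delta> \<longleftrightarrow> isLub UNIV {\<mu> K |K. compactin X K \<and> K \<subseteq> \<Delta>} (\<mu> \<Delta>)"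

definition weakly_inner_regular_at ::
  "'a topology \<Rightarrow> ('a set \<Rightarrow> 'e::ordered_real_vector ext_space) \<Rightarrow> 'a set \<Rightarrow> bool" where
  "weakly_inner_regular_at X \<mu> \<Delta> \<longleftrightarrow> isLub UNIV {\<mu> (\<Delta> \<inter> K) |K. compactin X K} (\<mu> \<Delta>)"

definition outer_regular_at ::
  "'a topology \<Rightarrow> ('a set \<Rightarrow> 'e::ordered_real_vector ext_space) \<Rightarrow> 'a set \<Rightarrow> bool" where
  "outer_regular_at X \<mu> \<Delta> \<longleftrightarrow> isGlb UNIV {\<mu> V |V. openin X V \<and> \<Delta> \<subseteq> V} (\<mu> \<Delta>)"

definition regular_borel_measure ::
  "'a topology \<Rightarrow> ('a set \<Rightarrow> 'e::ordered_real_vector ext_space) \<Rightarrow> bool" where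
  "regular_borel_measure X \<mu> \<longleftrightarrow>
     borel_ext_measure X \<mu> \<and>
     (\<forall>U. openin X U \<longrightarrow> inner_regular_at X \<mu> U) \<and>
     (\<forall>\<Delta>\<in>sets (borel_of X). outer_regular_at X \<mu> \<Delta>)"

definition quasi_regular_borel_measure ::
  "'a topology \<Rightarrow> ('a set \<Rightarrow> 'e::ordered_real_vector ext_space) \<Rightarrow> bool" where
  "quasi_regular_borel_measure X \<mu> \<longleftrightarrow>
     borel_ext_measure X \<mu> \<and>
     (\<forall>U. openin X U \<longrightarrow> inner_regular_at X \<mu> U) \<and>
     (\<forall>\<Delta>\<in>sets (borel_of X). weakly_inner_regular_at X \<mu> \<Delta>)"

definition relatively_compact_open :: "'a topology \<Rightarrow> 'a set \<Rightarrow> bool" where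
  "relatively_compact_open X U \<longleftrightarrow> openin X U \<and> compactin X (X closure_of U)"

section \<open>Positive operators on the continuous functions with compact support\<close>

text \<open>
  A function on \<^term>\<open>topspace X\<close> is represented by its extension by zero to the whole type, so that
  distinct elements of \<open>Cc X\<close> differ at a point of \<^term>\<open>topspace X\<close>.
\<close>

definition Cc :: "'a topology \<Rightarrow> ('a \<Rightarrow> real) set" where
  "Cc X = {f. continuous_map X euclideanreal f \<and>
              compactin X (X closure_of {x \<in> topspace X. f x \<noteq> 0}) \<and>
              (\<forall>x. x \<notin> topspace X \<longrightarrow> f x = 0)}"

definition positive_operator_Cc ::
  "'a topology \<Rightarrow> (('a \<Rightarrow> real) \<Rightarrow> 'e::ordered_real_vector) \<Rightarrow> bool" where
  "positive_operator_Cc X \<pi> \<longleftrightarrow>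
     (\<forall>f\<in>Cc X. \<forall>g\<in>Cc X. \<pi> (\<lambda>x. f x + g x) = \<pi> f + \<pi> g) \<and>
     (\<forall>f\<in>Cc X. \<forall>r. \<pi> (\<lambda>x. r * f x) = r *\<^sub>R \<pi> f) \<and>
     (\<forall>f\<in>Cc X. (\<forall>x\<in>topspace X. 0 \<le> f x) \<longrightarrow> 0 \<le> \<pi> f)"

definition represents ::
  "'a topology \<Rightarrow> ('a set \<Rightarrow> 'e::ordered_real_vector ext_space) \<Rightarrow> (('a \<Rightarrow> real) \<Rightarrow> 'e) \<Rightarrow> bool" where
  "represents X \<mu> \<pi> \<longleftrightarrow>
     (\<forall>f\<in>Cc X. order_integrable (borel_of X) \<mu> f \<and> \<pi> f = order_integral (borel_of X) \<mu> f)"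

definition is_representing_measure ::
  "'a topology \<Rightarrow> (('a \<Rightarrow> real) \<Rightarrow> 'e::ordered_real_vector) \<Rightarrow> ('a set \<Rightarrow> 'e ext_space) \<Rightarrow> bool" where
  "is_representing_measure X \<pi> \<mu> \<longleftrightarrow>
     ext_measure (borel_of X) \<mu> \<and>
     (\<forall>U. relatively_compact_open X U \<longrightarrow> regular_borel_measure (subtopology X U) \<mu>) \<and>
     (\<forall>\<Delta>\<in>sets (borel_of X). weakly_inner_regular_at X \<mu> \<Delta>) \<and>
     represents X \<mu> \<pi>"

end

theory Submission
  imports Defs
begin

text \<open>
  For a positive order continuous functional \<open>x'\<close>, the Riesz theorem represents the positive
  functional \<open>x' \<circ> \<pi>\<close> by a Radon measure. On Borel sets inside a compact set these scalar measures
  are the images under \<open>x'\<close> of a single vector in \<open>E\<close>: for an open set it is the supremum of the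
  values \<open>\<pi> f\<close> with \<open>f\<close> below the set, for a Borel set the infimum over surrounding open sets.
  Monotone completeness provides these vectors, order continuity identifies their images, and
  normality makes them unique and reduces all order relations, including countable additivity and
  the value of the order integral, to scalar ones. Suprema over compact sets extend the values to
  all Borel sets. Conversely, integrals of cutoff functions recover a representing measure at every
  open set where it is inner regular, which gives uniqueness and the comparison with a regular
  measure.
\<close>

section \<open>Suprema and infima\<close>

text \<open>The functionals do not detect infinity: an increasing sequence in \<open>E\<close> can
  be bounded under every one of them without having an upper bound, as (1,...,1,0,0,...) does in the
  space of null sequences. Scalar measures therefore settle a value only where a bound in
  \<open>E\<close> is at hand, which inside a compact set is \<open>\<pi> u\<close> for a cutoff
  function \<open>u\<close>. Elsewhere the value \<open>Infty\<close> only records that no finite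
  bound exists, and additivity there comes from exchanging suprema. The space need not be a lattice
  either, so every supremum must be directed. Directedness is supplied by the domain: maxima of
  functions, intersections of open sets, unions of compact sets. Since \<open>ennreal\<close> sends
  negative reals to 0, each transfer between vectors and scalar measures also carries the fact that
  the image of the vector is nonnegative.\<close>

lemma isLub_iff: "isLub UNIV S s \<longleftrightarrow> (\<forall>x\<in>S. x \<le> s) \<and> (\<forall>u. (\<forall>x\<in>S. x \<le> u) \<longrightarrow> s \<le> u)"
  by (auto simp: isLub_def leastP_def isUb_def setle_def setge_def)

lemma isGlb_iff: "isGlb UNIV S s \<longleftrightarrow> (\<forall>x\<in>S. s \<le> x) \<and> (\<forall>u. (\<forall>x\<in>S. u \<le> x) \<longrightarrow> u \<le> s)"
  by (auto simp: isGlb_def greatestP_def isLb_def setle_def setge_def)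

lemma isLub_upper: "isLub UNIV S s \<Longrightarrow> x \<in> S \<Longrightarrow> x \<le> s"
  and isLub_least: "isLub UNIV S s \<Longrightarrow> (\<And>x. x \<in> S \<Longrightarrow> x \<le> u) \<Longrightarrow> s \<le> u"
  and isGlb_lower: "isGlb UNIV S s \<Longrightarrow> x \<in> S \<Longrightarrow> s \<le> x"
  and isGlb_greatest: "isGlb UNIV S s \<Longrightarrow> (\<And>x. x \<in> S \<Longrightarrow> u \<le> x) \<Longrightarrow> u \<le> s"
  by (simp_all add: isLub_iff isGlb_iff)

lemma isLub_eqI:
  fixes s t :: "'a::order"
  shows "isLub UNIV S s \<Longrightarrow> isLub UNIV S t \<Longrightarrow> s = t"
  by (simp add: isLub_iff order_antisym)

lemma isGlb_eqI:
  fixes s t :: "'a::order"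
  shows "isGlb UNIV S s \<Longrightarrow> isGlb UNIV S t \<Longrightarrow> s = t"
  by (simp add: isGlb_iff order_antisym)

text \<open>This translates between the suprema that order continuity yields and those that define
  Riesz measures. Members below 0 would be lost under \<open>ennreal\<close>; a nonnegative member
  also forces the supremum to be nonnegative.\<close>

lemma isLub_real_iff:
  fixes S :: "real set"
  assumes "S \<noteq> {}" "\<And>x. x \<in> S \<Longrightarrow> 0 \<le> x"
  shows "isLub UNIV S s \<longleftrightarrow> 0 \<le> s \<and> (SUP x\<in>S. ennreal x) = ennreal s"
proof
  assume L: "isLub UNIV S s"
  then have "0 \<le> s"
    using assms by (meson all_not_in_conv isLubD2 order_trans)
  moreover have "(SUP x\<in>S. ennreal x) = ennreal s"
  proof (rule antisym)
    show "(SUP x\<in>S. ennreal x) \<le> ennreal s"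
      using L by (intro SUP_least ennreal_leI) (auto simp: isLub_iff)
    show "ennreal s \<le> (SUP x\<in>S. ennreal x)"
    proof (cases "(SUP x\<in>S. ennreal x)")
      case (real r)
      have "x \<le> r" if "x \<in> S" for x
        using SUP_upper[OF that, of ennreal] real by simp
      then show ?thesis
        using L real by (auto simp: isLub_iff intro: ennreal_leI)
    next
      case top
      then show ?thesis
        by (metis top_greatest)
    qed
  qed
  ultimately show "0 \<le> s \<and> (SUP x\<in>S. ennreal x) = ennreal s" ..
next
  assume R: "0 \<le> s \<and> (SUP x\<in>S. ennreal x) = ennreal s"
  have "x \<le> s" if "x \<in> S" for x
    using SUP_upper[OF that, of ennreal] R by simp
  moreover have "s \<le> u" if u: "\<And>x. x \<in> S \<Longrightarrow> x \<le> u" for u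
  proof -
    have "0 \<le> u"
      using assms u by (meson all_not_in_conv order_trans)
    moreover have "ennreal s \<le> ennreal u"
      using R u by (metis SUP_least ennreal_leI)
    ultimately show ?thesis
      by simp
  qed
  ultimately show "isLub UNIV S s"
    by (auto simp: isLub_iff)
qed

lemma isGlb_real_iff:
  fixes S :: "real set"
  assumes "S \<noteq> {}" "\<And>x. x \<in> S \<Longrightarrow> 0 \<le> x"
  shows "isGlb UNIV S s \<longleftrightarrow> 0 \<le> s \<and> (INF x\<in>S. ennreal x) = ennreal s"
proof
  assume G: "isGlb UNIV S s"
  then have "0 \<le> s"
    using assms by (simp add: isGlb_iff)
  moreover have "(INF x\<in>S. ennreal x) = ennreal s"
  proof (rule antisym)
    show "ennreal s \<le> (INF x\<in>S. ennreal x)"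
      using G by (intro INF_greatest ennreal_leI) (auto simp: isGlb_iff)
    show "(INF x\<in>S. ennreal x) \<le> ennreal s"
    proof (cases "INF x\<in>S. ennreal x")
      case (real r)
      have "r \<le> x" if "x \<in> S" for x
        using INF_lower[OF that, of ennreal] real assms(2)[OF that] by simp
      then show ?thesis
        using G real by (auto simp: isGlb_iff intro: ennreal_leI)
    next
      case top
      obtain x where "x \<in> S"
        using assms(1) by blast
      then have "(INF x\<in>S. ennreal x) \<le> ennreal x"
        by (rule INF_lower)
      with top show ?thesis
        by (simp add: top_unique)
    qed
  qed
  ultimately show "0 \<le> s \<and> (INF x\<in>S. ennreal x) = ennreal s" ..
next
  assume R: "0 \<le> s \<and> (INF x\<in>S. ennreal x) = ennreal s"
  have "s \<le> x" if "x \<in> S" for x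
    using INF_lower[OF that, of ennreal] R assms(2)[OF that] by simp
  moreover have "u \<le> s" if u: "\<And>x. x \<in> S \<Longrightarrow> u \<le> x" for u
    using R u by (metis INF_greatest ennreal_leI ennreal_le_iff)
  ultimately show "isGlb UNIV S s"
    by (auto simp: isGlb_iff)
qed

text \<open>Negation carries completeness, which is assumed for increasing nets, over to infima, and
  order continuity, which is assumed for decreasing nets, over to suprema.\<close>

lemma isLub_uminus_image:
  fixes S :: "'e::ordered_ab_group_add set"
  shows "isLub UNIV (uminus ` S) (- s) \<longleftrightarrow> isGlb UNIV S s"
  unfolding isLub_iff isGlb_iff by (auto simp: minus_le_iff) (metis le_imp_neg_le minus_minus)+

section \<open>Directed suprema and order continuous functionals\<close>

text \<open>Such a set, indexed by itself, is an increasing net. Working with sets avoids carrying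
  index sets and preorders through the proof.\<close>

definition up_directed :: "'b::order set \<Rightarrow> bool" where
  "up_directed S \<longleftrightarrow> S \<noteq> {} \<and> (\<forall>x\<in>S. \<forall>y\<in>S. \<exists>z\<in>S. x \<le> z \<and> y \<le> z)"

definition down_directed :: "'b::order set \<Rightarrow> bool" where
  "down_directed S \<longleftrightarrow> S \<noteq> {} \<and> (\<forall>x\<in>S. \<forall>y\<in>S. \<exists>z\<in>S. z \<le> x \<and> z \<le> y)"

lemma up_directed_uminus_image:
  fixes S :: "'e::ordered_ab_group_add set"
  shows "up_directed (uminus ` S) \<longleftrightarrow> down_directed S"
  by (auto simp: up_directed_def down_directed_def)

lemma up_directed_incseq: "incseq (f :: nat \<Rightarrow> 'b::order) \<Longrightarrow> up_directed (range f)"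
  by (auto simp: up_directed_def) (meson incseqD max.cobounded1 max.cobounded2)

lemma monotone_complete_Lub:
  fixes S :: "'e::ordered_real_vector set"
  assumes "monotone_complete TYPE('e)" "up_directed S" "\<And>x. x \<in> S \<Longrightarrow> x \<le> u"
  obtains s where "isLub UNIV S s"
proof -
  have "increasing_net S (\<le>) (\<lambda>x. x)"
    using assms(2) unfolding increasing_net_def directed_index_def up_directed_def monotone_on_def
    by (auto intro!: reflp_onI transp_onI)
  moreover have "isUb UNIV ((\<lambda>x. x) ` S) u"
    using assms(3) by (auto simp: isUb_def setle_def)
  ultimately show thesis
    using monotone_complete_net[OF assms(1)] that by (metis image_ident)
qed

lemma monotone_complete_Glb:
  fixes S :: "'e::ordered_real_vector set"
  assumes "monotone_complete TYPE('e)" "down_directed S" "\<And>x. x \<in> S \<Longrightarrow> u \<le> x"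
  obtains s where "isGlb UNIV S s"
proof -
  obtain s where "isLub UNIV (uminus ` S) s"
    by (rule monotone_complete_Lub[OF assms(1), of "uminus ` S" "- u"])
      (use assms in \<open>auto simp: up_directed_uminus_image\<close>)
  then show thesis
    using that[of "- s"] isLub_uminus_image[of S "- s"] by simp
qed

lemma oc_functional_linear: "x' \<in> positive_oc_functionals \<Longrightarrow> linear x'"
  by (simp add: positive_oc_functionals_def positive_functional_def)

lemma oc_functional_nonneg: "x' \<in> positive_oc_functionals \<Longrightarrow> 0 \<le> x \<Longrightarrow> 0 \<le> x' x"
  by (simp add: positive_oc_functionals_def positive_functional_def)

lemma oc_functional_mono: "x' \<in> positive_oc_functionals \<Longrightarrow> x \<le> y \<Longrightarrow> x' x \<le> x' y"
  using oc_functional_nonneg[of x' "y - x"] oc_functional_linear[of x'] by (simp add: linear_diff)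

text \<open>Order continuity speaks only of nets decreasing to 0. Translating by \<open>s\<close>
  and using linearity of \<open>x'\<close> extends it to an arbitrary infimum.\<close>

lemma oc_functional_Glb:
  fixes S :: "'e::ordered_real_vector set"
  assumes x': "x' \<in> positive_oc_functionals" and S: "down_directed S" "isGlb UNIV S s"
  shows "isGlb UNIV (x' ` S) (x' s)"
proof -
  \<comment> \<open>The value type is left general because the translation is needed twice: by
    \<open>s\<close> in the vector space and by \<open>x' s\<close> in the reals.\<close>
  have shift: "isGlb UNIV ((\<lambda>x. f x - c) ` S) 0 \<longleftrightarrow> isGlb UNIV (f ` S) c"
    for f :: "'e \<Rightarrow> 'c::ordered_ab_group_add" and c
    unfolding isGlb_iff
  proof safe
    fix u assume *: "\<forall>u. (\<forall>x\<in>(\<lambda>x. f x - c) ` S. u \<le> x) \<longrightarrow> u \<le> 0" and u: "\<forall>x\<in>f ` S. u \<le> x"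
    from u have "\<forall>x\<in>(\<lambda>x. f x - c) ` S. u - c \<le> x"
      by auto
    with * show "u \<le> c"
      by fastforce
  next
    fix u assume *: "\<forall>u. (\<forall>x\<in>f ` S. u \<le> x) \<longrightarrow> u \<le> c" and u: "\<forall>x\<in>(\<lambda>x. f x - c) ` S. u \<le> x"
    from u have "\<forall>x\<in>f ` S. u + c \<le> x"
      by (auto simp: le_diff_eq)
    with * show "u \<le> 0"
      by fastforce
  qed auto
  have "decreasing_net S (\<ge>) (\<lambda>x. x - s)"
    using S(1) unfolding decreasing_net_def directed_index_def down_directed_def monotone_on_def
    by (auto intro!: reflp_onI transp_onI)
  then have "net_decreases_to S (\<ge>) (\<lambda>x. x - s) 0"
    using S(2) shift[of "\<lambda>x. x" s] by (simp add: net_decreases_to_def)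
  then have "net_decreases_to S (\<ge>) (\<lambda>x. x' (x - s)) 0"
    using x' by (simp add: positive_oc_functionals_def order_continuous_def)
  then show ?thesis
    using oc_functional_linear[OF x'] shift[of x' "x' s"]
    by (simp add: net_decreases_to_def linear_diff)
qed

lemma oc_functional_Lub:
  fixes S :: "'e::ordered_real_vector set"
  assumes x': "x' \<in> positive_oc_functionals" and S: "up_directed S" "isLub UNIV S s"
  shows "isLub UNIV (x' ` S) (x' s)"
proof -
  have "isGlb UNIV (x' ` uminus ` S) (x' (- s))"
    using S isLub_uminus_image[of "uminus ` S" "- s"] up_directed_uminus_image[of "uminus ` S"]
    by (intro oc_functional_Glb x') (simp_all add: image_image)
  moreover have "x' ` uminus ` S = uminus ` x' ` S"
    using oc_functional_linear[OF x'] by (simp add: image_image linear_neg)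
  ultimately show ?thesis
    using isLub_uminus_image[of "uminus ` x' ` S" "- x' s"] oc_functional_linear[OF x']
    by (simp add: image_image linear_neg)
qed

lemma normal_le_iff:
  fixes x y :: "'e::ordered_real_vector"
  assumes "normal_ordered_space TYPE('e)"
  shows "x \<le> y \<longleftrightarrow> (\<forall>x'\<in>positive_oc_functionals. x' x \<le> x' y)"
proof -
  have "(\<forall>x'\<in>positive_oc_functionals. x' x \<le> x' y) \<longleftrightarrow>
      (\<forall>x'\<in>positive_oc_functionals. 0 \<le> x' (y - x))"
    by (intro ball_cong refl) (simp add: linear_diff[OF oc_functional_linear])
  also have "\<dots> \<longleftrightarrow> x \<le> y"
    using assms unfolding normal_ordered_space_def by simp
  finally show ?thesis
    by simp
qed

lemma normal_nonnegI:
  fixes x :: "'e::ordered_real_vector"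
  assumes "normal_ordered_space TYPE('e)" "\<And>x'. x' \<in> positive_oc_functionals \<Longrightarrow> 0 \<le> x' x"
  shows "0 \<le> x"
  using assms unfolding normal_ordered_space_def by blast

lemma normal_eqI:
  fixes x y :: "'e::ordered_real_vector"
  assumes "normal_ordered_space TYPE('e)" "\<And>x'. x' \<in> positive_oc_functionals \<Longrightarrow> x' x = x' y"
  shows "x = y"
  by (intro order_antisym) (auto simp: normal_le_iff[OF assms(1)] assms(2))

text \<open>An upper bound \<open>u\<close> of \<open>S\<close> yields the upper bound
  \<open>x' u\<close> of each image, so \<open>x' s \<le> x' u\<close> for every functional, and
  normality returns this to vectors.\<close>

lemma normal_LubI:
  fixes S :: "'e::ordered_real_vector set"
  assumes "normal_ordered_space TYPE('e)"
    and "\<And>x'. x' \<in> positive_oc_functionals \<Longrightarrow> isLub UNIV (x' ` S) (x' s)"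
  shows "isLub UNIV S s"
  using assms(2) unfolding isLub_iff by (auto simp: normal_le_iff[OF assms(1)])

lemma normal_GlbI:
  fixes S :: "'e::ordered_real_vector set"
  assumes "normal_ordered_space TYPE('e)"
    and "\<And>x'. x' \<in> positive_oc_functionals \<Longrightarrow> isGlb UNIV (x' ` S) (x' s)"
  shows "isGlb UNIV S s"
  using assms(2) unfolding isGlb_iff by (auto simp: normal_le_iff[OF assms(1)])

section \<open>The extended space\<close>

lemma Fin_le_Fin [simp]: "Fin a \<le> Fin b \<longleftrightarrow> a \<le> b"
  and le_Infty [simp]: "x \<le> Infty"
  and not_Infty_le_Fin [simp]: "\<not> Infty \<le> Fin b"
  by (simp_all add: less_eq_ext_space_def split: ext_space.splits)

lemma Fin_plus_Fin [simp]: "Fin a + Fin b = Fin (a + b)"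
  and Infty_plus [simp]: "Infty + x = Infty"
  and plus_Infty [simp]: "x + Infty = Infty"
  by (simp_all add: plus_ext_space_def split: ext_space.splits)

lemma ext_scale_Fin [simp]: "ext_scale r (Fin a) = Fin (r *\<^sub>R a)"
  and ext_scale_0 [simp]: "ext_scale 0 x = 0"
  by (simp_all add: ext_scale_def zero_ext_space_def split: ext_space.split)

lemma zero_le_Fin [simp]: "0 \<le> Fin a \<longleftrightarrow> 0 \<le> a"
  and Fin_eq_0 [simp]: "Fin a = 0 \<longleftrightarrow> a = 0"
  by (simp_all add: zero_ext_space_def)

lemma is_finite_Fin [simp]: "is_finite (Fin a)" "\<not> is_finite Infty"
  by (simp_all add: is_finite_def)

lemma Fin_fin_part: "is_finite x \<Longrightarrow> Fin (fin_part x) = x"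
  by (cases x) auto

lemma is_finite_le: "x \<le> y \<Longrightarrow> is_finite y \<Longrightarrow> is_finite (x :: 'e::order ext_space)"
  by (cases x; cases y) auto

lemma fin_part_nonneg: "0 \<le> x \<Longrightarrow> is_finite x \<Longrightarrow> 0 \<le> fin_part x"
  by (cases x) auto

lemma sum_Fin: "(\<Sum>i\<in>I. Fin (f i)) = Fin (\<Sum>i\<in>I. f i)"
  by (induction I rule: infinite_finite_induct) (auto simp: zero_ext_space_def)

lemma ext_add_mono:
  fixes a b c d :: "'e::ordered_real_vector ext_space"
  shows "a \<le> b \<Longrightarrow> c \<le> d \<Longrightarrow> a + c \<le> b + d"
  by (cases a; cases b; cases c; cases d) (auto intro: add_mono)

lemma ext_add_increasing:
  fixes a b :: "'e::ordered_real_vector ext_space"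
  shows "0 \<le> b \<Longrightarrow> a \<le> a + b"
  by (cases a; cases b) auto

lemma isLub_Fin_image_iff:
  assumes "S \<noteq> {}"
  shows "isLub UNIV (Fin ` S) (Fin s) \<longleftrightarrow> isLub UNIV S (s :: 'e::order)"
proof
  assume *: "isLub UNIV S s"
  have "Fin s \<le> u" if "\<forall>x\<in>Fin ` S. x \<le> u" for u
    using that * by (cases u) (auto simp: isLub_iff)
  then show "isLub UNIV (Fin ` S) (Fin s)"
    using * by (auto simp: isLub_iff)
next
  assume *: "isLub UNIV (Fin ` S) (Fin s)"
  have "s \<le> u" if "\<forall>x\<in>S. x \<le> u" for u
    using that * unfolding isLub_iff by (metis (no_types, opaque_lifting) Fin_le_Fin imageE)
  then show "isLub UNIV S s"
    using * by (auto simp: isLub_iff)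
qed

lemma isGlb_Fin_image:
  assumes "S \<noteq> {}" "isGlb UNIV S (s :: 'e::order)"
  shows "isGlb UNIV (Fin ` S) (Fin s)"
proof -
  have "u \<le> Fin s" if "\<forall>x\<in>Fin ` S. u \<le> x" for u
    using that assms by (cases u) (auto simp: isGlb_iff)
  then show ?thesis
    using assms by (auto simp: isGlb_iff)
qed

text \<open>A finite bound makes all members finite, so monotone completeness applies; without one,
  \<open>Infty\<close> is the only upper bound. Adjoining one point thus makes every directed set
  have a supremum.\<close>

lemma ext_directed_Lub:
  fixes S :: "'e::ordered_real_vector ext_space set"
  assumes mc: "monotone_complete TYPE('e)" and S: "up_directed S"
  obtains s where "isLub UNIV S s"
proof (cases "\<exists>u. \<forall>x\<in>S. x \<le> Fin u")
  case True
  then obtain u where u: "\<forall>x\<in>S. x \<le> Fin u"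
    by blast
  define T where "T = {a. Fin a \<in> S}"
  have ST: "S = Fin ` T"
  proof (intro equalityI subsetI)
    fix x assume "x \<in> S"
    then show "x \<in> Fin ` T"
      using u by (cases x) (auto simp: T_def)
  qed (auto simp: T_def)
  have "up_directed T"
    using S unfolding ST up_directed_def by auto
  then obtain s where "isLub UNIV T s"
    by (rule monotone_complete_Lub[OF mc, of T u]) (use u in \<open>auto simp: ST\<close>)
  then have "isLub UNIV S (Fin s)"
    using S unfolding ST by (subst isLub_Fin_image_iff) (auto simp: up_directed_def)
  then show thesis
    by (rule that)
next
  case False
  have "isLub UNIV S Infty"
    unfolding isLub_iff
  proof safe
    fix u assume "\<forall>x\<in>S. x \<le> u"
    with False show "Infty \<le> u"
      by (cases u) auto
  qed auto
  then show thesis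
    by (rule that)
qed

text \<open>Directedness bounds the mixed sums \<open>a i + b j\<close> by diagonal ones
  \<open>a k + b k\<close>. For a finite bound of the latter, the two suprema are then reached one
  at a time by subtraction.\<close>

lemma ext_Lub_add:
  fixes a b :: "'i \<Rightarrow> 'e::ordered_real_vector ext_space"
  assumes dir: "\<And>i j. i \<in> I \<Longrightarrow> j \<in> I \<Longrightarrow> \<exists>k\<in>I. a i \<le> a k \<and> a j \<le> a k \<and> b i \<le> b k \<and> b j \<le> b k"
    and ne: "I \<noteq> {}"
    and lub: "isLub UNIV (a ` I) s" "isLub UNIV (b ` I) t"
  shows "isLub UNIV ((\<lambda>i. a i + b i) ` I) (s + t)"
  unfolding isLub_iff
proof (intro conjI ballI allI impI)
  show "x \<le> s + t" if "x \<in> (\<lambda>i. a i + b i) ` I" for x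
    using that lub by (auto simp: isLub_iff intro: ext_add_mono)
next
  fix u assume u: "\<forall>x\<in>(\<lambda>i. a i + b i) ` I. x \<le> u"
  show "s + t \<le> u"
  proof (cases u)
    case (Fin v)
    have fin: "is_finite (a i) \<and> is_finite (b i)" if "i \<in> I" for i
      using u that Fin by (cases "a i"; cases "b i") auto
    define a' b' where "a' i = fin_part (a i)" and "b' i = fin_part (b i)" for i
    have ab: "a i = Fin (a' i)" "b i = Fin (b' i)" if "i \<in> I" for i
      using fin[OF that] by (auto simp: a'_def b'_def Fin_fin_part)
    have le: "a' i + b' j \<le> v" if ij: "i \<in> I" "j \<in> I" for i j
    proof -
      obtain k where k: "k \<in> I" "a i \<le> a k" "b j \<le> b k"
        using dir[OF ij] by blast
      have "a' k + b' k \<le> v"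
        using u k(1) Fin ab by force
      moreover have "a' i + b' j \<le> a' k + b' k"
        using k ij ab by (intro add_mono) auto
      ultimately show ?thesis
        by simp
    qed
    \<comment> \<open>Fixing \<open>j\<close> and taking the supremum over \<open>i\<close> also
      shows that \<open>s\<close> is finite, so it can be subtracted in turn before the supremum
      over \<open>j\<close> is taken.\<close>
    have "s \<le> Fin (v - b' j)" if "j \<in> I" for j
      using lub(1) le that ab unfolding isLub_iff by (auto simp: le_diff_eq)
    then obtain s' where s': "s = Fin s'" "\<And>j. j \<in> I \<Longrightarrow> s' \<le> v - b' j"
      using ne by (cases s) auto
    then have "t \<le> Fin (v - s')"
      using lub(2) ab unfolding isLub_iff by (auto simp: le_diff_eq add.commute)
    then show ?thesis
      using s' Fin by (cases t) (auto simp: le_diff_eq add.commute)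
  qed simp
qed

text \<open>This exchanges a supremum over compact sets with the partial sums in countable
  additivity. One index dominates for all \<open>n\<close> at once, so it serves every partial
  sum.\<close>

lemma ext_Lub_sum:
  fixes a :: "nat \<Rightarrow> 'i \<Rightarrow> 'e::ordered_real_vector ext_space"
  assumes dir: "\<And>i j. i \<in> I \<Longrightarrow> j \<in> I \<Longrightarrow> \<exists>k\<in>I. \<forall>n. a n i \<le> a n k \<and> a n j \<le> a n k"
    and ne: "I \<noteq> {}"
    and lub: "\<And>n. isLub UNIV (a n ` I) (s n)"
  shows "isLub UNIV ((\<lambda>i. \<Sum>n\<le>N. a n i) ` I) (\<Sum>n\<le>N. s n)"
proof (induction N)
  case 0
  then show ?case
    using lub[of 0] by simp
next
  case (Suc N)
  have mono: "(\<Sum>n\<le>N. a n i) \<le> (\<Sum>n\<le>N. a n k)" if "\<forall>n. a n i \<le> a n k" for i k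
    using that by (induction N) (auto intro: ext_add_mono)
  show ?case
    unfolding sum.atMost_Suc
    by (rule ext_Lub_add[OF _ ne Suc lub]) (use dir mono in meson)+
qed

section \<open>Continuous functions with compact support\<close>

abbreviation supp :: "'a topology \<Rightarrow> ('a \<Rightarrow> real) \<Rightarrow> 'a set" where
  "supp X f \<equiv> X closure_of {x \<in> topspace X. f x \<noteq> 0}"

text \<open>This is the usual relation "f is subordinate to V" of Riesz theory. Requiring the closed
  support, and not just the nonzero set, to lie in \<open>V\<close> makes covering arguments
  possible.\<close>

definition Cc_below :: "'a topology \<Rightarrow> 'a set \<Rightarrow> ('a \<Rightarrow> real) set" where
  "Cc_below X V = {f \<in> Cc X. (\<forall>x. 0 \<le> f x \<and> f x \<le> 1) \<and> supp X f \<subseteq> V}"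

lemma Cc_continuous: "f \<in> Cc X \<Longrightarrow> continuous_map X euclideanreal f"
  and Cc_compact_supp: "f \<in> Cc X \<Longrightarrow> compactin X (supp X f)"
  and Cc_off_space: "f \<in> Cc X \<Longrightarrow> x \<notin> topspace X \<Longrightarrow> f x = 0"
  by (simp_all add: Cc_def)

lemma Cc_eq_0:
  assumes "f \<in> Cc X" "x \<notin> supp X f"
  shows "f x = 0"
proof (rule ccontr)
  assume "f x \<noteq> 0"
  then have "x \<in> {x \<in> topspace X. f x \<noteq> 0}"
    using assms(1) Cc_off_space by fastforce
  then have "x \<in> supp X f"
    using closure_of_subset[of "{x \<in> topspace X. f x \<noteq> 0}" X] by blast
  with assms(2) show False ..
qed

lemma Cc_belowD:
  assumes "f \<in> Cc_below X V"
  shows "f \<in> Cc X" "0 \<le> f x" "f x \<le> 1" "supp X f \<subseteq> V"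
  using assms by (auto simp: Cc_below_def)

lemma Cc_below_mono: "V \<subseteq> W \<Longrightarrow> Cc_below X V \<subseteq> Cc_below X W"
  by (auto simp: Cc_below_def)

lemma Cc_below_eq_0: "f \<in> Cc_below X V \<Longrightarrow> x \<notin> V \<Longrightarrow> f x = 0"
  using Cc_eq_0[of f X x] by (auto dest: Cc_belowD)

text \<open>Only the zero set matters: it controls the support, and a closed subset of a compact set
  is compact. Products with bounded or unbounded continuous factors, truncations and multiples are
  all covered.\<close>

lemma Cc_dominated:
  assumes "f \<in> Cc X" "continuous_map X euclideanreal g" "\<And>x. f x = 0 \<Longrightarrow> g x = 0"
  shows "g \<in> Cc X" "supp X g \<subseteq> supp X f"
proof -
  show *: "supp X g \<subseteq> supp X f"
    using assms(3) by (intro closure_of_mono) auto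
  show "g \<in> Cc X"
    using assms closed_compactin[OF Cc_compact_supp[OF assms(1)] *] by (simp add: Cc_def)
qed

lemma Cc_0: "(\<lambda>x. 0) \<in> Cc X"
  by (simp add: Cc_def)

lemma Cc_scale: "f \<in> Cc X \<Longrightarrow> (\<lambda>x. c * f x) \<in> Cc X"
  by (rule Cc_dominated(1)) (auto intro: continuous_intros Cc_continuous)

lemma Cc_minus: "f \<in> Cc X \<Longrightarrow> (\<lambda>x. - f x) \<in> Cc X"
  by (rule Cc_dominated(1)) (auto intro: continuous_intros Cc_continuous)

lemma Cc_pos_part: "f \<in> Cc X \<Longrightarrow> (\<lambda>x. max (f x) 0) \<in> Cc X"
  by (rule Cc_dominated(1)[of f]) (auto intro: continuous_intros Cc_continuous)

lemma Cc_abs: "f \<in> Cc X \<Longrightarrow> (\<lambda>x. \<bar>f x\<bar>) \<in> Cc X"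
  by (rule Cc_dominated(1)) (auto intro: continuous_intros Cc_continuous)

lemma Cc_add:
  assumes "f \<in> Cc X" "g \<in> Cc X"
  shows "(\<lambda>x. f x + g x) \<in> Cc X" "supp X (\<lambda>x. f x + g x) \<subseteq> supp X f \<union> supp X g"
proof -
  show *: "supp X (\<lambda>x. f x + g x) \<subseteq> supp X f \<union> supp X g"
    unfolding closure_of_Un[symmetric] by (intro closure_of_mono) auto
  have "compactin X (supp X (\<lambda>x. f x + g x))"
    by (rule closed_compactin[OF compactin_Un[OF assms[THEN Cc_compact_supp]] *]) simp
  then show "(\<lambda>x. f x + g x) \<in> Cc X"
    using assms by (auto simp: Cc_def intro: continuous_intros)
qed

lemma Cc_diff:
  assumes "f \<in> Cc X" "g \<in> Cc X"
  shows "(\<lambda>x. f x - g x) \<in> Cc X"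
  using Cc_add(1)[OF assms(1) Cc_minus[OF assms(2)]] by simp

lemma Cc_max:
  assumes "f \<in> Cc X" "g \<in> Cc X"
  shows "(\<lambda>x. max (f x) (g x)) \<in> Cc X" "supp X (\<lambda>x. max (f x) (g x)) \<subseteq> supp X f \<union> supp X g"
proof -
  show *: "supp X (\<lambda>x. max (f x) (g x)) \<subseteq> supp X f \<union> supp X g"
    unfolding closure_of_Un[symmetric] by (intro closure_of_mono) auto
  have "compactin X (supp X (\<lambda>x. max (f x) (g x)))"
    by (rule closed_compactin[OF compactin_Un[OF assms[THEN Cc_compact_supp]] *]) simp
  then show "(\<lambda>x. max (f x) (g x)) \<in> Cc X"
    using assms by (auto simp: Cc_def intro: continuous_intros)
qed

lemma Cc_bounded:
  assumes "f \<in> Cc X"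
  obtains B where "0 < B" "\<And>x. \<bar>f x\<bar> \<le> B"
proof -
  have "compactin euclideanreal (f ` supp X f)"
    by (rule image_compactin[OF Cc_compact_supp[OF assms] Cc_continuous[OF assms]])
  then obtain B where B: "0 < B" "\<And>x. x \<in> supp X f \<Longrightarrow> \<bar>f x\<bar> \<le> B"
    by (auto simp: compactin_euclidean_iff dest!: compact_imp_bounded simp: bounded_pos)
  have "\<bar>f x\<bar> \<le> B" for x
    using B Cc_eq_0[OF assms, of x] by (cases "x \<in> supp X f") auto
  with B(1) show thesis
    by (rule that)
qed

lemma Cc_below_0: "(\<lambda>x. 0) \<in> Cc_below X V"
  by (simp add: Cc_below_def Cc_0)

lemma Cc_below_max:
  assumes "f \<in> Cc_below X V" "g \<in> Cc_below X V"
  shows "(\<lambda>x. max (f x) (g x)) \<in> Cc_below X V"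
proof -
  note f = Cc_belowD[OF assms(1)] and g = Cc_belowD[OF assms(2)]
  show ?thesis
    unfolding Cc_below_def using f g Cc_max[OF f(1) g(1)] by (auto simp: le_max_iff_disj)
qed

text \<open>The bound 1 survives addition because at each point at most one summand is nonzero. This
  is the source of additivity of the content on disjoint pieces.\<close>

lemma Cc_below_disjoint_add:
  assumes "f \<in> Cc_below X V" "g \<in> Cc_below X (V - supp X f)"
  shows "(\<lambda>x. f x + g x) \<in> Cc_below X V"
proof -
  note f = Cc_belowD[OF assms(1)] and g = Cc_belowD[OF assms(2)]
  have "f x + g x \<le> 1" for x
  proof (cases "x \<in> supp X f")
    case True
    with g(4) have "x \<notin> supp X g"
      by blast
    then show ?thesis
      using f(3)[of x] Cc_eq_0[OF g(1)] by simp
  next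
    case False
    then show ?thesis
      using g(3)[of x] Cc_eq_0[OF f(1)] by simp
  qed
  then show ?thesis
    using f g Cc_add[OF f(1) g(1)] unfolding Cc_below_def by (auto intro: add_nonneg_nonneg)
qed

text \<open>Compactness of the support reduces countable subadditivity of the content to finite
  unions.\<close>

lemma Cc_below_UN_lessThan:
  fixes V :: "nat \<Rightarrow> 'a set"
  assumes "f \<in> Cc_below X (\<Union>n. V n)" "\<And>n. openin X (V n)"
  obtains N where "f \<in> Cc_below X (\<Union>n<N. V n)"
proof -
  have "compactin X (supp X f)" "supp X f \<subseteq> \<Union> (range V)"
    using Cc_belowD[OF assms(1)] by (auto intro: Cc_compact_supp)
  then have "\<exists>\<F>. finite \<F> \<and> \<F> \<subseteq> range V \<and> supp X f \<subseteq> \<Union>\<F>"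
    using assms(2) by (intro compactinD) auto
  then obtain \<F> where "finite \<F>" "\<F> \<subseteq> range V" "supp X f \<subseteq> \<Union>\<F>"
    by blast
  then obtain I where I: "finite I" "supp X f \<subseteq> \<Union>(V ` I)"
    using finite_subset_image[of \<F> V UNIV] by blast
  then obtain N where "I \<subseteq> {..<N}"
    using finite_nat_iff_bounded by blast
  with I have "supp X f \<subseteq> (\<Union>n<N. V n)"
    by blast
  then have "f \<in> Cc_below X (\<Union>n<N. V n)"
    using assms(1) by (simp add: Cc_below_def)
  then show thesis
    by (rule that)
qed

lemma Cc_borel_measurable:
  assumes "f \<in> Cc X"
  shows "f \<in> borel_measurable (borel_of X)"
proof (rule borel_measurableI)
  fix S :: "real set"
  assume "open S"
  then have "openin X {x \<in> topspace X. f x \<in> S}"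
    using Cc_continuous[OF assms] by (simp add: openin_continuous_map_preimage)
  moreover have "f -` S \<inter> space (borel_of X) = {x \<in> topspace X. f x \<in> S}"
    by (auto simp: space_borel_of)
  ultimately show "f -` S \<inter> space (borel_of X) \<in> sets (borel_of X)"
    by (simp add: sets_borel_of sigma_sets.Basic)
qed

lemma openin_borel_of: "openin X U \<Longrightarrow> U \<in> sets (borel_of X)"
  by (simp add: sets_borel_of sigma_sets.Basic)

lemma closedin_borel_of: "closedin X C \<Longrightarrow> C \<in> sets (borel_of X)"
  using sets.compl_sets[OF openin_borel_of, of X "topspace X - C"]
  by (auto simp: closedin_def space_borel_of double_diff)

subsection \<open>Positive operators\<close>

context
  fixes X :: "'a topology" and \<pi> :: "('a \<Rightarrow> real) \<Rightarrow> 'e::ordered_real_vector"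
  assumes pos: "positive_operator_Cc X \<pi>"
begin

lemma positive_operator_add: "f \<in> Cc X \<Longrightarrow> g \<in> Cc X \<Longrightarrow> \<pi> (\<lambda>x. f x + g x) = \<pi> f + \<pi> g"
  and positive_operator_scale: "f \<in> Cc X \<Longrightarrow> \<pi> (\<lambda>x. r * f x) = r *\<^sub>R \<pi> f"
  and positive_operator_nonneg: "f \<in> Cc X \<Longrightarrow> (\<And>x. x \<in> topspace X \<Longrightarrow> 0 \<le> f x) \<Longrightarrow> 0 \<le> \<pi> f"
  using pos by (auto simp: positive_operator_Cc_def)

lemma positive_operator_0: "\<pi> (\<lambda>x. 0) = 0"
  using positive_operator_scale[OF Cc_0, of 0] by simp

lemma positive_operator_diff:
  assumes "f \<in> Cc X" "g \<in> Cc X"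
  shows "\<pi> (\<lambda>x. f x - g x) = \<pi> f - \<pi> g"
  using positive_operator_add[OF Cc_diff[OF assms] assms(2)] by simp

lemma positive_operator_mono:
  assumes "f \<in> Cc X" "g \<in> Cc X" "\<And>x. x \<in> topspace X \<Longrightarrow> f x \<le> g x"
  shows "\<pi> f \<le> \<pi> g"
  using positive_operator_nonneg[OF Cc_diff[OF assms(2,1)]] positive_operator_diff[OF assms(2,1)] assms(3)
  by simp

lemma positive_operator_below_nonneg: "f \<in> Cc_below X V \<Longrightarrow> 0 \<le> \<pi> f"
  by (auto intro: positive_operator_nonneg dest: Cc_belowD)

text \<open>The maximum is taken among functions, where it stays below \<open>V\<close>; positivity
  then provides the common bound, so no maximum of two vectors is formed.\<close>

lemma positive_operator_below_directed: "up_directed (\<pi> ` Cc_below X V)"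
  unfolding up_directed_def
proof (intro conjI ballI)
  show "\<pi> ` Cc_below X V \<noteq> {}"
    using Cc_below_0 by blast
next
  fix a b assume "a \<in> \<pi> ` Cc_below X V" "b \<in> \<pi> ` Cc_below X V"
  then obtain f g where fg: "f \<in> Cc_below X V" "g \<in> Cc_below X V" "a = \<pi> f" "b = \<pi> g"
    by auto
  have "\<pi> f \<le> \<pi> (\<lambda>x. max (f x) (g x))" "\<pi> g \<le> \<pi> (\<lambda>x. max (f x) (g x))"
    using fg Cc_belowD(1)[OF Cc_below_max[OF fg(1,2)]] by (auto intro!: positive_operator_mono dest: Cc_belowD)
  then show "\<exists>z\<in>\<pi> ` Cc_below X V. a \<le> z \<and> b \<le> z"
    using Cc_below_max[OF fg(1,2)] fg(3,4) by blast
qed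

end

lemma oc_functional_positive_operator:
  assumes "positive_operator_Cc X \<pi>" "x' \<in> positive_oc_functionals"
  shows "positive_operator_Cc X (\<lambda>f. x' (\<pi> f))"
  using assms(1) linear_add[OF oc_functional_linear[OF assms(2)]]
    linear_scale[OF oc_functional_linear[OF assms(2)]] oc_functional_nonneg[OF assms(2)]
  unfolding positive_operator_Cc_def by simp

subsection \<open>Cutoff functions\<close>

locale locally_compact_Hausdorff =
  fixes X :: "'a topology"
  assumes locally_compact: "locally_compact_space X" and Hausdorff: "Hausdorff_space X"
begin

lemma compactin_closedin: "compactin X K \<Longrightarrow> closedin X K"
  by (rule compactin_imp_closedin[OF Hausdorff])

lemma compactin_borel_of: "compactin X K \<Longrightarrow> K \<in> sets (borel_of X)"
  by (intro closedin_borel_of compactin_closedin)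

lemma compact_neighbourhood:
  assumes "compactin X K"
  obtains U where "openin X U" "compactin X (X closure_of U)" "K \<subseteq> U"
proof -
  obtain U L where U: "openin X U" "compactin X L" "closedin X L" "K \<subseteq> U" "U \<subseteq> L"
    using locally_compact assms locally_compact_space_compact_closed_compact Hausdorff by metis
  then have "compactin X (X closure_of U)"
    by (meson closed_compactin closedin_closure_of closure_of_minimal)
  with U show thesis
    by (intro that)
qed

text \<open>The open set \<open>N\<close> on which \<open>f\<close> is 1 is the gain over the plain
  Urysohn lemma: it keeps the closed support of \<open>1 - f\<close> away from
  \<open>K\<close>.\<close>

lemma cutoff_function:
  assumes "compactin X K" "openin X V" "K \<subseteq> V"
  obtains f N where "f \<in> Cc_below X V" "openin X N" "K \<subseteq> N" "\<And>x. x \<in> N \<Longrightarrow> f x = 1"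
proof -
  obtain U where U: "openin X U" "compactin X (X closure_of U)" "K \<subseteq> U"
    using compact_neighbourhood[OF assms(1)] .
  let ?T = "topspace X - U \<inter> V"
  have "closedin X ?T"
    using U assms by blast
  moreover have "disjnt K ?T"
    using U assms by (auto simp: disjnt_def)
  \<comment> \<open>The values 2 and -1 leave room for truncation to the interval from 0 to 1. The
    set where \<open>h\<close> exceeds 1 is an open neighbourhood of \<open>K\<close>, and the
    closed set where \<open>h\<close> is nonnegative, which contains the support, misses
    \<open>?T\<close>.\<close>
  ultimately obtain h where h: "continuous_map X euclideanreal h" "h ` K \<subseteq> {2}" "h ` ?T \<subseteq> {-1}"
    using Urysohn_completely_regular_compact_closed_alt[of X K ?T "-1::real" 2]
      locally_compact_regular_imp_completely_regular_space[OF locally_compact disjI1[OF Hausdorff]] assms(1)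
    by metis
  define f where "f x = (if x \<in> topspace X then min 1 (max 0 (h x)) else 0)" for x
  have contf: "continuous_map X euclideanreal f"
    by (rule continuous_map_eq[of _ _ "\<lambda>x. min 1 (max 0 (h x))"])
      (auto intro!: continuous_intros h(1) simp: f_def)
  let ?C = "{x \<in> topspace X. h x \<in> {0..}}"
  have C: "closedin X ?C"
    by (rule closedin_continuous_map_preimage[OF h(1)]) simp
  have CUV: "?C \<subseteq> U \<inter> V"
    using h(3) by force
  then have "compactin X ?C"
    using C closed_compactin[OF U(2) _ C] closure_of_subset[OF openin_subset[OF U(1)]] by blast
  moreover have supp: "supp X f \<subseteq> ?C"
    using C by (intro closure_of_minimal) (auto simp: f_def)
  ultimately have "compactin X (supp X f)"
    by (rule closed_compactin) simp
  then have "f \<in> Cc X"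
    using contf by (simp add: Cc_def f_def)
  then have "f \<in> Cc_below X V"
    unfolding Cc_below_def using order_trans[OF supp CUV] by (simp add: f_def[of x for x])
  moreover have "openin X {x \<in> topspace X. h x \<in> {1<..}}"
    by (rule openin_continuous_map_preimage[OF h(1)]) simp
  moreover have "K \<subseteq> {x \<in> topspace X. h x \<in> {1<..}}"
    using h(2) compactin_subset_topspace[OF assms(1)] by force
  ultimately show thesis
    by (rule that) (auto simp: f_def)
qed

text \<open>A two-set partition of unity: \<open>u\<close> is 1 near the part of the support of
  \<open>f\<close> outside \<open>W\<close>, so \<open>u f\<close> lives in \<open>V\<close>, while
  \<open>(1 - u) f\<close> vanishes on that neighbourhood and so has its support in
  \<open>W\<close>.\<close>

lemma Cc_below_Un_split:
  assumes f: "f \<in> Cc_below X (V \<union> W)" and V: "openin X V" and W: "openin X W"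
  obtains g h where "g \<in> Cc_below X V" "h \<in> Cc_below X W" "f = (\<lambda>x. g x + h x)"
proof -
  note f = Cc_belowD[OF f]
  have 1: "compactin X (supp X f \<inter> (topspace X - W))"
    using W by (intro compact_Int_closedin Cc_compact_supp f(1)) auto
  have 2: "supp X f \<inter> (topspace X - W) \<subseteq> V"
    using f(4) by auto
  obtain u N where u: "u \<in> Cc_below X V" "openin X N"
      "supp X f \<inter> (topspace X - W) \<subseteq> N" "\<And>x. x \<in> N \<Longrightarrow> u x = 1"
    by (rule cutoff_function[OF 1 V 2]) blast
  note u' = Cc_belowD[OF u(1)]
  have cont: "continuous_map X euclideanreal (\<lambda>x. u x * f x)"
      "continuous_map X euclideanreal (\<lambda>x. (1 - u x) * f x)"
    by (intro continuous_intros Cc_continuous f(1) u'(1))+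
  have "(\<lambda>x. u x * f x) \<in> Cc X" "supp X (\<lambda>x. u x * f x) \<subseteq> V"
    using Cc_dominated[OF u'(1) cont(1)] u'(4) by auto
  moreover have "u x * f x \<le> 1" for x
    using f(2,3)[of x] u'(2,3)[of x] by (simp add: mult_le_one)
  ultimately have g: "(\<lambda>x. u x * f x) \<in> Cc_below X V"
    using f u' by (auto simp: Cc_below_def)
  have h: "(\<lambda>x. (1 - u x) * f x) \<in> Cc X" "supp X (\<lambda>x. (1 - u x) * f x) \<subseteq> supp X f"
    using Cc_dominated[OF f(1) cont(2)] by auto
  have "supp X (\<lambda>x. (1 - u x) * f x) \<subseteq> topspace X - N"
    using u(2,4) by (intro closure_of_minimal) auto
  with h(2) u(3) have "supp X (\<lambda>x. (1 - u x) * f x) \<subseteq> W"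
    by blast
  moreover have "(1 - u x) * f x \<le> 1" for x
    using f(2,3)[of x] u'(2,3)[of x] by (simp add: mult_le_one)
  ultimately have "(\<lambda>x. (1 - u x) * f x) \<in> Cc_below X W"
    using h(1) f u' by (auto simp: Cc_below_def)
  then show thesis
    by (rule that[OF g]) (auto simp: algebra_simps)
qed

end

section \<open>The Riesz representation of positive functionals\<close>

definition content_open :: "'a topology \<Rightarrow> (('a \<Rightarrow> real) \<Rightarrow> real) \<Rightarrow> 'a set \<Rightarrow> ennreal" where
  "content_open X L V = (SUP f\<in>Cc_below X V. ennreal (L f))"

definition riesz_outer :: "'a topology \<Rightarrow> (('a \<Rightarrow> real) \<Rightarrow> real) \<Rightarrow> 'a set \<Rightarrow> ennreal" where
  "riesz_outer X L A = (INF V\<in>{V. openin X V \<and> A \<subseteq> V}. content_open X L V)"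

text \<open>\<open>measure_of\<close> takes the prescribed values only for a countably additive set
  function. That this holds on Borel sets is the content of
  \<open>emeasure_riesz_measure\<close>.\<close>

definition riesz_measure :: "'a topology \<Rightarrow> (('a \<Rightarrow> real) \<Rightarrow> real) \<Rightarrow> 'a measure" where
  "riesz_measure X L = measure_of (topspace X) (sets (borel_of X)) (riesz_outer X L)"

locale riesz = locally_compact_Hausdorff X for X :: "'a topology" +
  fixes L :: "('a \<Rightarrow> real) \<Rightarrow> real"
  assumes positive: "positive_operator_Cc X L"
begin

lemma L_nonneg: "f \<in> Cc_below X V \<Longrightarrow> 0 \<le> L f"
  by (rule positive_operator_below_nonneg[OF positive])

lemma content_open_upper: "f \<in> Cc_below X V \<Longrightarrow> ennreal (L f) \<le> content_open X L V"
  unfolding content_open_def by (rule SUP_upper)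

lemma content_open_mono: "V \<subseteq> W \<Longrightarrow> content_open X L V \<le> content_open X L W"
  unfolding content_open_def by (intro SUP_subset_mono Cc_below_mono) auto

lemma content_open_empty: "content_open X L {} = 0"
proof -
  have "L f = 0" if "f \<in> Cc_below X {}" for f
  proof -
    have "f = (\<lambda>x. 0)"
      using Cc_below_eq_0[OF that] by auto
    then show ?thesis
      using positive_operator_0[OF positive] by simp
  qed
  then show ?thesis
    unfolding content_open_def by (intro antisym SUP_least) auto
qed

lemma content_open_Un:
  assumes "openin X V" "openin X W"
  shows "content_open X L (V \<union> W) \<le> content_open X L V + content_open X L W"
  unfolding content_open_def[of X L "V \<union> W"]
proof (rule SUP_least)
  fix f assume "f \<in> Cc_below X (V \<union> W)"
  then obtain g h where gh: "g \<in> Cc_below X V" "h \<in> Cc_below X W" "f = (\<lambda>x. g x + h x)"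
    using Cc_below_Un_split[OF _ assms] by metis
  then have "L f = L g + L h"
    using positive_operator_add[OF positive] by (simp add: Cc_belowD)
  then show "ennreal (L f) \<le> content_open X L V + content_open X L W"
    using gh by (simp add: L_nonneg ennreal_plus add_mono content_open_upper)
qed

lemma content_open_UN:
  fixes V :: "nat \<Rightarrow> 'a set"
  assumes "\<And>n. openin X (V n)"
  shows "content_open X L (\<Union>n. V n) \<le> (\<Sum>n. content_open X L (V n))"
  unfolding content_open_def[of X L "\<Union>n. V n"]
proof (rule SUP_least)
  fix f assume f: "f \<in> Cc_below X (\<Union>n. V n)"
  obtain N where N: "f \<in> Cc_below X (\<Union>n<N. V n)"
    using Cc_below_UN_lessThan[OF f] assms by blast
  have "content_open X L (\<Union>n<N. V n) \<le> (\<Sum>n<N. content_open X L (V n))"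
  proof (induction N)
    case (Suc N)
    have "content_open X L (\<Union>n<Suc N. V n) = content_open X L ((\<Union>n<N. V n) \<union> V N)"
      by (simp add: lessThan_Suc Un_commute)
    also have "\<dots> \<le> content_open X L (\<Union>n<N. V n) + content_open X L (V N)"
      by (intro content_open_Un) (auto intro: assms)
    also have "\<dots> \<le> (\<Sum>n<Suc N. content_open X L (V n))"
      using Suc by (simp add: add_right_mono)
    finally show ?case .
  qed (simp add: content_open_empty)
  also have "\<dots> \<le> (\<Sum>n. content_open X L (V n))"
    by (rule sum_le_suminf) auto
  finally show "ennreal (L f) \<le> (\<Sum>n. content_open X L (V n))"
    using content_open_upper[OF N] by (rule order_trans[rotated])
qed

lemma riesz_outer_open: "openin X V \<Longrightarrow> riesz_outer X L V = content_open X L V"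
  unfolding riesz_outer_def
  by (intro antisym INF_greatest INF_lower) (auto intro: content_open_mono)

lemma riesz_outer_le: "openin X V \<Longrightarrow> A \<subseteq> V \<Longrightarrow> riesz_outer X L A \<le> content_open X L V"
  unfolding riesz_outer_def by (rule INF_lower) simp

lemma riesz_outer_mono: "A \<subseteq> B \<Longrightarrow> riesz_outer X L A \<le> riesz_outer X L B"
  unfolding riesz_outer_def by (rule INF_superset_mono) auto

section \<open>The outer measure and Caratheodory measurability\<close>

lemma riesz_outer_subadditive:
  fixes A :: "nat \<Rightarrow> 'a set"
  shows "riesz_outer X L (\<Union>n. A n) \<le> (\<Sum>n. riesz_outer X L (A n))"
proof (rule ennreal_le_epsilon)
  fix e :: real
  assume e: "0 < e" and fin: "(\<Sum>n. riesz_outer X L (A n)) < top"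
  have "\<exists>V. openin X V \<and> A n \<subseteq> V \<and>
      content_open X L V \<le> riesz_outer X L (A n) + ennreal e * ennreal ((1/2)^Suc n)" for n
  proof -
    have "riesz_outer X L (A n) < top"
      using fin by (rule ennreal_suminf_lessD)
    then have "riesz_outer X L (A n) < riesz_outer X L (A n) + ennreal e * ennreal ((1/2)^Suc n)"
      using e by (simp add: ennreal_zero_less_mult_iff)
    then show ?thesis
      unfolding riesz_outer_def[of X L "A n"] INF_less_iff
      by (auto simp: riesz_outer_def intro: less_imp_le)
  qed
  then obtain V where V: "\<And>n. openin X (V n)" "\<And>n. A n \<subseteq> V n"
      "\<And>n. content_open X L (V n) \<le> riesz_outer X L (A n) + ennreal e * ennreal ((1/2)^Suc n)"
    by metis
  have "riesz_outer X L (\<Union>n. A n) \<le> content_open X L (\<Union>n. V n)"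
    using V(1,2) by (intro riesz_outer_le) (auto intro!: UN_mono)
  also have "\<dots> \<le> (\<Sum>n. content_open X L (V n))"
    using V(1) by (rule content_open_UN)
  also have "\<dots> \<le> (\<Sum>n. riesz_outer X L (A n) + ennreal e * ennreal ((1/2)^Suc n))"
    using V(3) by (intro suminf_le) auto
  also have "\<dots> = (\<Sum>n. riesz_outer X L (A n)) + (\<Sum>n. ennreal e * ennreal ((1/2)^Suc n))"
    by (rule suminf_add[symmetric]) auto
  also have "(\<Sum>n. ennreal e * ennreal ((1/2)^Suc n)) = ennreal e"
    unfolding ennreal_suminf_cmult
    by (subst suminf_ennreal_eq[OF zero_le_power power_half_series]) auto
  finally show "riesz_outer X L (\<Union>n. A n) \<le> (\<Sum>n. riesz_outer X L (A n)) + ennreal e" .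
qed

lemma riesz_outer_measure_space: "outer_measure_space (Pow (topspace X)) (riesz_outer X L)"
  unfolding outer_measure_space_def positive_def increasing_def countably_subadditive_def
  by (auto simp: riesz_outer_open content_open_empty intro: riesz_outer_mono riesz_outer_subadditive)

text \<open>For \<open>f\<close> below \<open>V \<inter> U\<close>, the remainder
  \<open>V - U\<close> lies in the open set \<open>V - supp X f\<close>, and any \<open>g\<close>
  below that set can be added to \<open>f\<close> without leaving \<open>V\<close>. Suprema over
  \<open>g\<close> and then over \<open>f\<close> give the estimate.\<close>

lemma content_open_split:
  assumes V: "openin X V" and U: "openin X U"
  shows "riesz_outer X L (V \<inter> U) + riesz_outer X L (V - U) \<le> content_open X L V"
proof -
  have le: "ennreal (L f) + riesz_outer X L (V - U) \<le> content_open X L V"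
    if f: "f \<in> Cc_below X (V \<inter> U)" for f
  proof -
    have fV: "f \<in> Cc_below X V"
      using f by (auto simp: Cc_below_def)
    have op: "openin X (V - supp X f)"
      using V by (simp add: openin_diff)
    have "riesz_outer X L (V - U) \<le> content_open X L (V - supp X f)"
      using Cc_belowD(4)[OF f] by (intro riesz_outer_le[OF op]) auto
    then have "ennreal (L f) + riesz_outer X L (V - U) \<le> ennreal (L f) + content_open X L (V - supp X f)"
      by (rule add_left_mono)
    also have "\<dots> = (SUP g\<in>Cc_below X (V - supp X f). ennreal (L f) + ennreal (L g))"
      unfolding content_open_def using Cc_below_0 by (intro ennreal_SUP_add_right) auto
    also have "\<dots> \<le> content_open X L V"
    proof (rule SUP_least)
      fix g assume g: "g \<in> Cc_below X (V - supp X f)"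
      have "ennreal (L f) + ennreal (L g) = ennreal (L (\<lambda>x. f x + g x))"
        using f g L_nonneg[OF f] L_nonneg[OF g]
        by (simp add: positive_operator_add[OF positive] Cc_belowD(1))
      also have "\<dots> \<le> content_open X L V"
        by (intro content_open_upper Cc_below_disjoint_add[OF fV g])
      finally show "ennreal (L f) + ennreal (L g) \<le> content_open X L V" .
    qed
    finally show ?thesis .
  qed
  have "riesz_outer X L (V \<inter> U) + riesz_outer X L (V - U) =
      (SUP f\<in>Cc_below X (V \<inter> U). ennreal (L f) + riesz_outer X L (V - U))"
    using V U Cc_below_0[of X "V \<inter> U"]
    by (subst riesz_outer_open)
      (auto simp: content_open_def openin_Int intro!: ennreal_SUP_add_left[symmetric])
  also have "\<dots> \<le> content_open X L V"
    by (intro SUP_least le)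
  finally show ?thesis .
qed

text \<open>The outer measure of any test set is an infimum over open sets, so the nontrivial
  Caratheodory inequality need only be known for open test sets, where
  \<open>content_open_split\<close> gives it.\<close>

lemma openin_lambda_system:
  assumes U: "openin X U"
  shows "U \<in> lambda_system (topspace X) (Pow (topspace X)) (riesz_outer X L)"
proof -
  have "riesz_outer X L (U \<inter> A) + riesz_outer X L ((topspace X - U) \<inter> A) = riesz_outer X L A"
    if A: "A \<subseteq> topspace X" for A
  proof (rule antisym)
    show "riesz_outer X L (U \<inter> A) + riesz_outer X L ((topspace X - U) \<inter> A) \<le> riesz_outer X L A"
      unfolding riesz_outer_def[of X L A]
    proof (rule INF_greatest)
      fix V assume "V \<in> {V. openin X V \<and> A \<subseteq> V}"
      then have V: "openin X V" "A \<subseteq> V"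
        by auto
      have "riesz_outer X L (U \<inter> A) + riesz_outer X L ((topspace X - U) \<inter> A)
          \<le> riesz_outer X L (V \<inter> U) + riesz_outer X L (V - U)"
        using V by (intro add_mono riesz_outer_mono) auto
      also have "\<dots> \<le> content_open X L V"
        by (rule content_open_split[OF V(1) U])
      finally show "riesz_outer X L (U \<inter> A) + riesz_outer X L ((topspace X - U) \<inter> A)
          \<le> content_open X L V" .
    qed
    let ?B = "\<lambda>n::nat. if n = 0 then U \<inter> A else if n = 1 then (topspace X - U) \<inter> A else {}"
    have "riesz_outer X L A \<le> riesz_outer X L (\<Union>n. ?B n)"
      using A by (intro riesz_outer_mono) (auto split: if_splits)
    also have "\<dots> \<le> (\<Sum>n. riesz_outer X L (?B n))"
      by (rule riesz_outer_subadditive)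
    also have "\<dots> = (\<Sum>n\<in>{0,1}. riesz_outer X L (?B n))"
      by (rule suminf_finite) (auto simp: riesz_outer_open content_open_empty)
    also have "\<dots> = riesz_outer X L (U \<inter> A) + riesz_outer X L ((topspace X - U) \<inter> A)"
      by simp
    finally show "riesz_outer X L A \<le> riesz_outer X L (U \<inter> A) + riesz_outer X L ((topspace X - U) \<inter> A)" .
  qed
  then show ?thesis
    using openin_subset[OF U] by (auto simp: lambda_system_def)
qed

lemma sets_riesz_measure [simp]: "sets (riesz_measure X L) = sets (borel_of X)"
  unfolding riesz_measure_def
  by (metis sets.sets_measure_of_eq space_borel_of)

lemma space_riesz_measure [simp]: "space (riesz_measure X L) = topspace X"
  using sets_eq_imp_space_eq[OF sets_riesz_measure] by (simp add: space_borel_of)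

lemma emeasure_riesz_measure:
  assumes "A \<in> sets (borel_of X)"
  shows "emeasure (riesz_measure X L) A = riesz_outer X L A"
proof -
  let ?S = "lambda_system (topspace X) (Pow (topspace X)) (riesz_outer X L)"
  have S: "measure_space (topspace X) ?S (riesz_outer X L)"
    by (rule sigma_algebra.caratheodory_lemma[OF sigma_algebra_Pow riesz_outer_measure_space])
  have "sets (borel_of X) \<subseteq> ?S"
    unfolding sets_borel_of using S openin_lambda_system
    by (intro sigma_algebra.sigma_sets_subset) (auto simp: measure_space_def)
  moreover have "sigma_algebra (topspace X) (sets (borel_of X))"
    using sets.sigma_algebra_axioms[of "borel_of X"] by (simp add: space_borel_of)
  ultimately have "measure_space (topspace X) (sets (borel_of X)) (riesz_outer X L)"
    using measure_down[OF S] by blast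
  then show ?thesis
    using assms unfolding riesz_measure_def measure_space_def
    by (intro emeasure_measure_of_sigma) auto
qed

lemma emeasure_riesz_open:
  "openin X V \<Longrightarrow> emeasure (riesz_measure X L) V = (SUP f\<in>Cc_below X V. ennreal (L f))"
  by (simp add: emeasure_riesz_measure openin_borel_of riesz_outer_open content_open_def)

lemma emeasure_riesz_outer_regular:
  assumes "A \<in> sets (borel_of X)"
  shows "emeasure (riesz_measure X L) A =
    (INF V\<in>{V. openin X V \<and> A \<subseteq> V}. emeasure (riesz_measure X L) V)"
  unfolding emeasure_riesz_measure[OF assms] riesz_outer_def[of X L A]
  by (intro INF_cong refl) (simp add: emeasure_riesz_measure openin_borel_of riesz_outer_open)

text \<open>A function that is at least 1 on \<open>N\<close> dominates everything subordinate to
  \<open>N\<close>. This yields finiteness on compact sets and one side of the comparison of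
  \<open>L\<close> with the integral.\<close>

lemma riesz_measure_le_functional:
  assumes f: "f \<in> Cc X" "\<And>x. 0 \<le> f x" and N: "openin X N" "\<And>x. x \<in> N \<Longrightarrow> 1 \<le> f x"
  shows "emeasure (riesz_measure X L) N \<le> ennreal (L f)"
  unfolding emeasure_riesz_open[OF N(1)]
proof (rule SUP_least)
  fix g assume g: "g \<in> Cc_below X N"
  have "g x \<le> f x" for x
    using Cc_belowD(3)[OF g, of x] Cc_below_eq_0[OF g, of x] f(2)[of x] N(2)[of x]
    by (cases "x \<in> N") auto
  then show "ennreal (L g) \<le> ennreal (L f)"
    using Cc_belowD(1)[OF g] f(1) by (intro ennreal_leI positive_operator_mono[OF positive])
qed

lemma emeasure_riesz_compact_finite:
  assumes "compactin X K"
  shows "emeasure (riesz_measure X L) K < top"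
proof -
  obtain f N where fN: "f \<in> Cc_below X (topspace X)" "openin X N" "K \<subseteq> N" "\<And>x. x \<in> N \<Longrightarrow> f x = 1"
    by (rule cutoff_function[OF assms openin_topspace compactin_subset_topspace[OF assms]]) blast
  have "emeasure (riesz_measure X L) K \<le> emeasure (riesz_measure X L) N"
    using fN by (intro emeasure_mono) (auto intro: openin_borel_of)
  also have "\<dots> \<le> ennreal (L f)"
    using fN Cc_belowD[OF fN(1)] by (intro riesz_measure_le_functional) auto
  also have "\<dots> < top"
    by simp
  finally show ?thesis .
qed

end

subsection \<open>Comparison of positive functionals\<close>

text \<open>The summand with index \<open>i\<close> is the length of the part of the interval from 0
  to \<open>t\<close> that lies between \<open>i\<close> and \<open>i + 1\<close>.\<close>

lemma sum_layers:
  fixes t :: real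
  assumes "0 \<le> t"
  shows "(\<Sum>i<n. min 1 (max 0 (t - real i))) = min t (real n)"
  using assms by (induction n) auto

lemma Cc_layer:
  assumes f: "f \<in> Cc X" and r: "0 \<le> r"
  shows "(\<lambda>x. min 1 (max 0 (c * f x - r))) \<in> Cc_below X (supp X f)"
proof -
  have "continuous_map X euclideanreal (\<lambda>x. min 1 (max 0 (c * f x - r)))"
    by (intro continuous_intros Cc_continuous f)
  then show ?thesis
    using Cc_dominated[OF f] r by (simp add: Cc_below_def)
qed

text \<open>The gap between \<open>s\<close> and \<open>r\<close> is essential: the support may
  contain boundary points of the nonzero set, but stays in the closed set
  \<open>{c f \<ge> r}\<close>, hence in the open set \<open>{c f > s}\<close>.\<close>

lemma Cc_layer_superlevel:
  assumes f: "f \<in> Cc X" and r: "0 \<le> r" "s < r"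
  shows "(\<lambda>x. min 1 (max 0 (c * f x - r))) \<in> Cc_below X {x \<in> topspace X. s < c * f x}"
proof -
  have "continuous_map X euclideanreal (\<lambda>x. c * f x)"
    by (intro continuous_intros Cc_continuous f)
  then have "closedin X {x \<in> topspace X. c * f x \<in> {r..}}"
    by (rule closedin_continuous_map_preimage) simp
  then have "supp X (\<lambda>x. min 1 (max 0 (c * f x - r))) \<subseteq> {x \<in> topspace X. c * f x \<in> {r..}}"
    by (intro closure_of_minimal) auto
  also have "\<dots> \<subseteq> {x \<in> topspace X. s < c * f x}"
    using r by auto
  finally show ?thesis
    using Cc_belowD(1)[OF Cc_layer[OF f r(1)]] by (auto simp: Cc_below_def)
qed

lemma openin_superlevel:
  assumes "f \<in> Cc X"
  shows "openin X {x \<in> topspace X. s < c * f x}"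
proof -
  have "continuous_map X euclideanreal (\<lambda>x. c * f x)"
    by (intro continuous_intros Cc_continuous assms)
  then have "openin X {x \<in> topspace X. c * f x \<in> {s<..}}"
    by (rule openin_continuous_map_preimage) simp
  then show ?thesis
    by simp
qed

lemma Cc_sum: "(\<And>i. f i \<in> Cc X) \<Longrightarrow> (\<lambda>x. \<Sum>i<n. f i x) \<in> Cc X" for n :: nat
  by (induction n) (simp_all add: Cc_0 Cc_add)

lemma positive_operator_sum:
  fixes n :: nat
  assumes pos: "positive_operator_Cc X \<pi>" and f: "\<And>i. f i \<in> Cc X"
  shows "\<pi> (\<lambda>x. \<Sum>i<n. f i x) = (\<Sum>i<n. \<pi> (f i))"
  by (induction n)
    (simp_all add: positive_operator_0[OF pos] positive_operator_add[OF pos] Cc_sum f)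

text \<open>
  Cutting \<open>n f\<close> into its layers \<open>f\<^sub>i = min 1 (max 0 (n f - i))\<close>, the hypothesis compares the
  value of \<open>\<Phi>\<close> at \<open>f\<^sub>i\<^sub>+\<^sub>2\<close> with that of \<open>\<Psi>\<close> at \<open>f\<^sub>i\<close> through the open set \<open>{n f > i + 1}\<close>.
\<close>

lemma (in locally_compact_Hausdorff) functional_le_functional:
  fixes \<Phi> \<Psi> :: "('a \<Rightarrow> real) \<Rightarrow> real"
  assumes pos: "positive_operator_Cc X \<Phi>" "positive_operator_Cc X \<Psi>"
    and cmp: "\<And>g h N. openin X N \<Longrightarrow> g \<in> Cc_below X N \<Longrightarrow> h \<in> Cc X \<Longrightarrow> (\<And>x. 0 \<le> h x) \<Longrightarrow>
      (\<And>x. x \<in> N \<Longrightarrow> 1 \<le> h x) \<Longrightarrow> \<Phi> g \<le> \<Psi> h"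
    and f: "f \<in> Cc X" "\<And>x. 0 \<le> f x" "\<And>x. f x \<le> 1"
  shows "\<Phi> f \<le> \<Psi> f"
proof -
  obtain u N where u: "u \<in> Cc_below X (topspace X)" "openin X N" "supp X f \<subseteq> N" "\<And>x. x \<in> N \<Longrightarrow> u x = 1"
    by (rule cutoff_function[OF Cc_compact_supp[OF f(1)] openin_topspace closure_of_subset_topspace]) blast
  note u' = Cc_belowD[OF u(1)]
  \<comment> \<open>The shift by two leaves the layers 0 and 1 unmatched. Each costs at most
    \<open>\<Phi> u\<close>, whatever \<open>n\<close> is, so the error is negligible after division
    by \<open>n\<close>.\<close>
  have bound: "real n * (\<Phi> f - \<Psi> f) \<le> 2 * \<Phi> u" for n
  proof -
    define F where "F i = (\<lambda>x. min 1 (max 0 (real n * f x - real i)))" for i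
    have F: "F i \<in> Cc_below X (supp X f)" for i
      unfolding F_def by (rule Cc_layer[OF f(1)]) simp
    note F' = Cc_belowD[OF F]
    have sum: "(\<lambda>x. \<Sum>i<n. F i x) = (\<lambda>x. real n * f x)"
    proof
      fix x
      have "(\<Sum>i<n. F i x) = min (real n * f x) (real n)"
        unfolding F_def by (rule sum_layers) (simp add: f)
      also have "\<dots> = real n * f x"
        using f(3)[of x] by (simp add: min_def mult_left_le)
      finally show "(\<Sum>i<n. F i x) = real n * f x" .
    qed
    have scale: "(\<Sum>i<n. \<Theta> (F i)) = real n * \<Theta> f" if "positive_operator_Cc X \<Theta>" for \<Theta> :: "_ \<Rightarrow> real"
      using positive_operator_sum[OF that, of F n] F' positive_operator_scale[OF that f(1), of "real n"]
      by (simp add: sum)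
    have step: "\<Phi> (F (Suc (Suc i))) \<le> \<Psi> (F i)" for i
    proof (rule cmp)
      show "openin X {x \<in> topspace X. real (Suc i) < real n * f x}"
        by (rule openin_superlevel[OF f(1)])
      show "F (Suc (Suc i)) \<in> Cc_below X {x \<in> topspace X. real (Suc i) < real n * f x}"
        unfolding F_def by (rule Cc_layer_superlevel[OF f(1)]) simp_all
      show "1 \<le> F i x" if "x \<in> {x \<in> topspace X. real (Suc i) < real n * f x}" for x
        using that by (simp add: F_def)
    qed (rule F')+
    have le_u: "\<Phi> (F i) \<le> \<Phi> u" for i
    proof (rule positive_operator_mono[OF pos(1) F'(1) u'(1)])
      show "F i x \<le> u x" for x
        using u(3,4) u'(2)[of x] F'(3)[of i x] Cc_below_eq_0[OF F, of x i] by (cases "x \<in> supp X f") auto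
    qed
    have "real n * \<Phi> f = (\<Sum>i<n. \<Phi> (F i))"
      using scale[OF pos(1)] by simp
    also have "\<dots> \<le> (\<Sum>i<Suc (Suc n). \<Phi> (F i))"
      using positive_operator_below_nonneg[OF pos(1) F] by (intro sum_mono2) auto
    also have "\<dots> = \<Phi> (F 0) + \<Phi> (F 1) + (\<Sum>i<n. \<Phi> (F (Suc (Suc i))))"
      by (simp add: sum.lessThan_Suc_shift del: sum.lessThan_Suc)
    also have "\<dots> \<le> \<Phi> u + \<Phi> u + (\<Sum>i<n. \<Psi> (F i))"
      by (intro add_mono sum_mono le_u step)
    also have "\<dots> = 2 * \<Phi> u + real n * \<Psi> f"
      using scale[OF pos(2)] by simp
    finally show ?thesis
      by (simp add: algebra_simps)
  qed
  show ?thesis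
  proof (rule ccontr)
    assume "\<not> \<Phi> f \<le> \<Psi> f"
    then have "0 < \<Phi> f - \<Psi> f"
      by simp
    then obtain n where "2 * \<Phi> u < real n * (\<Phi> f - \<Psi> f)"
      using reals_Archimedean3 by blast
    with bound[of n] show False
      by simp
  qed
qed

section \<open>Agreement of the functional with its integral\<close>

context riesz
begin

lemma riesz_integrable:
  assumes f: "f \<in> Cc X"
  shows "integrable (riesz_measure X L) f"
proof -
  let ?M = "riesz_measure X L"
  obtain B where B: "0 < B" "\<And>x. \<bar>f x\<bar> \<le> B"
    using Cc_bounded[OF f] by blast
  have K: "supp X f \<in> sets ?M"
    by (simp add: compactin_borel_of[OF Cc_compact_supp[OF f]])
  have "integrable ?M (\<lambda>x. B * indicator (supp X f) x)"
    using emeasure_riesz_compact_finite[OF Cc_compact_supp[OF f]] K by simp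
  then show ?thesis
  proof (rule Bochner_Integration.integrable_bound)
    show "f \<in> borel_measurable ?M"
      using Cc_borel_measurable[OF f] by (simp cong: measurable_cong_sets)
    have "norm (f x) \<le> norm (B * indicator (supp X f) x)" for x
      using B Cc_eq_0[OF f, of x] by (auto simp: indicator_def)
    then show "AE x in ?M. norm (f x) \<le> norm (B * indicator (supp X f) x)"
      by simp
  qed
qed

lemma riesz_integral_positive: "positive_operator_Cc X (\<lambda>f. \<integral>x. f x \<partial>riesz_measure X L)"
  unfolding positive_operator_Cc_def
  by (auto simp: riesz_integrable intro: Bochner_Integration.integral_nonneg)

lemma riesz_nn_integral:
  assumes "f \<in> Cc X" "\<And>x. 0 \<le> f x"
  shows "(\<integral>\<^sup>+x. ennreal (f x) \<partial>riesz_measure X L) = ennreal (\<integral>x. f x \<partial>riesz_measure X L)"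
  using assms by (intro nn_integral_eq_integral riesz_integrable) auto

lemma riesz_integral_below:
  assumes "openin X N" "g \<in> Cc_below X N"
  shows "ennreal (\<integral>x. g x \<partial>riesz_measure X L) \<le> emeasure (riesz_measure X L) N"
proof -
  have "ennreal (\<integral>x. g x \<partial>riesz_measure X L) = (\<integral>\<^sup>+x. ennreal (g x) \<partial>riesz_measure X L)"
    using assms(2) by (simp add: riesz_nn_integral Cc_belowD)
  also have "\<dots> \<le> (\<integral>\<^sup>+x. indicator N x \<partial>riesz_measure X L)"
    using Cc_belowD(3)[OF assms(2)] Cc_below_eq_0[OF assms(2)]
    by (intro nn_integral_mono) (auto simp: indicator_def)
  finally show ?thesis
    using openin_borel_of[OF assms(1)] by simp
qed

lemma riesz_integral_above:
  assumes "openin X N" "h \<in> Cc X" "\<And>x. 0 \<le> h x" "\<And>x. x \<in> N \<Longrightarrow> 1 \<le> h x"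
  shows "emeasure (riesz_measure X L) N \<le> ennreal (\<integral>x. h x \<partial>riesz_measure X L)"
proof -
  have "emeasure (riesz_measure X L) N = (\<integral>\<^sup>+x. indicator N x \<partial>riesz_measure X L)"
    using openin_borel_of[OF assms(1)] by simp
  also have "\<dots> \<le> (\<integral>\<^sup>+x. ennreal (h x) \<partial>riesz_measure X L)"
    using assms(4) by (intro nn_integral_mono) (auto simp: indicator_def)
  finally show ?thesis
    using assms by (simp add: riesz_nn_integral)
qed

text \<open>The measure of an open set \<open>N\<close> separates values in both orders: for
  \<open>g\<close> below \<open>N\<close> and \<open>h\<close> at least 1 on \<open>N\<close>, it
  lies between \<open>L g\<close> and the integral of \<open>h\<close>, and also between the
  integral of \<open>g\<close> and \<open>L h\<close>. Hence the comparison of functionals applies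
  in both directions.\<close>

lemma riesz_integral_unit:
  assumes f: "f \<in> Cc X" "\<And>x. 0 \<le> f x" "\<And>x. f x \<le> 1"
  shows "(\<integral>x. f x \<partial>riesz_measure X L) = L f"
proof (rule antisym)
  have nonneg: "0 \<le> L h" "0 \<le> (\<integral>x. h x \<partial>riesz_measure X L)" if "h \<in> Cc X" "\<And>x. 0 \<le> h x" for h
    using that positive_operator_nonneg[OF positive] by (auto intro: Bochner_Integration.integral_nonneg)
  show "(\<integral>x. f x \<partial>riesz_measure X L) \<le> L f"
  proof (rule functional_le_functional[OF riesz_integral_positive positive _ f])
    fix g h N assume *: "openin X N" "g \<in> Cc_below X N" "h \<in> Cc X" "\<And>x. 0 \<le> h x" "\<And>x. x \<in> N \<Longrightarrow> 1 \<le> h x"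
    have "ennreal (\<integral>x. g x \<partial>riesz_measure X L) \<le> ennreal (L h)"
      using riesz_integral_below[OF *(1,2)] riesz_measure_le_functional[OF *(3,4,1,5)]
      by (rule order_trans)
    then show "(\<integral>x. g x \<partial>riesz_measure X L) \<le> L h"
      using nonneg(1)[OF *(3,4)] by simp
  qed
  show "L f \<le> (\<integral>x. f x \<partial>riesz_measure X L)"
  proof (rule functional_le_functional[OF positive riesz_integral_positive _ f])
    fix g h N assume *: "openin X N" "g \<in> Cc_below X N" "h \<in> Cc X" "\<And>x. 0 \<le> h x" "\<And>x. x \<in> N \<Longrightarrow> 1 \<le> h x"
    have "ennreal (L g) \<le> emeasure (riesz_measure X L) N"
      unfolding emeasure_riesz_open[OF *(1)] by (rule SUP_upper[OF *(2)])
    also have "\<dots> \<le> ennreal (\<integral>x. h x \<partial>riesz_measure X L)"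
      by (rule riesz_integral_above[OF *(1,3,4,5)])
    finally show "L g \<le> (\<integral>x. h x \<partial>riesz_measure X L)"
      using nonneg(2)[OF *(3,4)] by simp
  qed
qed

theorem riesz_representation:
  assumes f: "f \<in> Cc X" "\<And>x. 0 \<le> f x"
  shows "(\<integral>\<^sup>+x. ennreal (f x) \<partial>riesz_measure X L) = ennreal (L f)"
proof -
  obtain B where B: "0 < B" "\<And>x. \<bar>f x\<bar> \<le> B"
    using Cc_bounded[OF f(1)] by blast
  have g: "(\<lambda>x. inverse B * f x) \<in> Cc X"
    by (rule Cc_scale[OF f(1)])
  have le: "inverse B * f x \<le> 1" for x
    using B(1) B(2)[of x] f(2)[of x] by (simp add: field_simps)
  have "inverse B * (\<integral>x. f x \<partial>riesz_measure X L) = inverse B * L f"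
    using riesz_integral_unit[OF g _ le] positive_operator_scale[OF positive f(1), of "inverse B"] B(1) f(2)
    by simp
  with B(1) show ?thesis
    using riesz_nn_integral[OF f] by simp
qed

end

section \<open>Measures with values in the extended space\<close>

lemma ext_measure_nonneg: "ext_measure M \<nu> \<Longrightarrow> A \<in> sets M \<Longrightarrow> 0 \<le> \<nu> A"
  and ext_measure_empty: "ext_measure M \<nu> \<Longrightarrow> \<nu> {} = 0"
  and ext_measure_UN: "ext_measure M \<nu> \<Longrightarrow> range D \<subseteq> sets M \<Longrightarrow> disjoint_family D \<Longrightarrow>
    isLub UNIV (range (\<lambda>N. \<Sum>n\<le>N. \<nu> (D n))) (\<nu> (\<Union>n. D n))" for D :: "nat \<Rightarrow> 'a set"
  unfolding ext_measure_def by blast+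

lemma ext_measure_Un:
  assumes \<nu>: "ext_measure M \<nu>" and AB: "A \<in> sets M" "B \<in> sets M" "A \<inter> B = {}"
  shows "\<nu> (A \<union> B) = \<nu> A + \<nu> B"
proof -
  let ?D = "\<lambda>n::nat. if n = 0 then A else if n = 1 then B else {}"
  have "(\<Union>n. ?D n) = A \<union> B"
    by (auto split: if_splits)
  moreover have "isLub UNIV (range (\<lambda>N. \<Sum>n\<le>N. \<nu> (?D n))) (\<nu> (\<Union>n. ?D n))"
    using AB by (intro ext_measure_UN[OF \<nu>]) (auto simp: disjoint_family_on_def)
  ultimately have lub: "isLub UNIV (range (\<lambda>N. \<Sum>n\<le>N. \<nu> (?D n))) (\<nu> (A \<union> B))"
    by simp
  have sum: "(\<Sum>n\<le>N. \<nu> (?D n)) = (if N = 0 then \<nu> A else \<nu> A + \<nu> B)" for N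
  proof (induction N)
    case (Suc N)
    then show ?case
      using ext_measure_empty[OF \<nu>] by simp
  qed simp
  have "isLub UNIV (range (\<lambda>N. \<Sum>n\<le>N. \<nu> (?D n))) (\<nu> A + \<nu> B)"
    unfolding sum isLub_iff
    using ext_add_increasing[OF ext_measure_nonneg[OF \<nu> AB(2)], of "\<nu> A"] by (auto split: if_splits)
  with lub show ?thesis
    by (rule isLub_eqI)
qed

lemma ext_measure_mono:
  assumes \<nu>: "ext_measure M \<nu>" and AB: "A \<in> sets M" "B \<in> sets M" "A \<subseteq> B"
  shows "\<nu> A \<le> \<nu> B"
proof -
  have "\<nu> B = \<nu> (A \<union> (B - A))"
    using AB by (simp add: Un_absorb1)
  also have "\<dots> = \<nu> A + \<nu> (B - A)"
    using AB by (intro ext_measure_Un[OF \<nu>]) auto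
  finally show ?thesis
    using ext_add_increasing[OF ext_measure_nonneg[OF \<nu>], of "B - A" "\<nu> A"] AB by auto
qed

text \<open>Finiteness at \<open>K\<close> keeps all partial sums in the vector space, where order
  continuity of \<open>x'\<close> turns the order supremum in countable additivity into a supremum
  of reals.\<close>

lemma ext_measure_functional:
  fixes \<nu> :: "'a set \<Rightarrow> 'e::ordered_real_vector ext_space"
  assumes \<nu>: "ext_measure M \<nu>" and K: "K \<in> sets M" "is_finite (\<nu> K)"
    and x': "x' \<in> positive_oc_functionals"
  obtains N where "sets N = sets M"
    "\<And>A. A \<in> sets M \<Longrightarrow> A \<subseteq> K \<Longrightarrow> emeasure N A = ennreal (x' (fin_part (\<nu> A)))"
proof -
  \<comment> \<open>Cutting every set with \<open>K\<close> gives a set function on the whole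
    sigma-algebra, to which the construction of measures applies.\<close>
  define g where "g A = fin_part (\<nu> (A \<inter> K))" for A
  have g: "\<nu> (A \<inter> K) = Fin (g A)" if "A \<in> sets M" for A
    unfolding g_def using ext_measure_mono[OF \<nu>, of "A \<inter> K" K] K that
    by (intro Fin_fin_part[symmetric]) (auto intro: is_finite_le)
  have g_nonneg: "0 \<le> g A" if "A \<in> sets M" for A
    using ext_measure_nonneg[OF \<nu>, of "A \<inter> K"] K(1) that by (simp add: g)
  have x'g: "0 \<le> x' (g A)" if "A \<in> sets M" for A
    by (rule oc_functional_nonneg[OF x' g_nonneg[OF that]])
  define N where "N = measure_of (space M) (sets M) (\<lambda>A. ennreal (x' (g A)))"
  have "countably_additive (sets M) (\<lambda>A. ennreal (x' (g A)))"
  proof (rule countably_additiveI)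
    fix D :: "nat \<Rightarrow> 'a set"
    assume D: "range D \<subseteq> sets M" "disjoint_family D" "\<Union> (range D) \<in> sets M"
    have D': "D n \<in> sets M" for n
      using D(1) by auto
    let ?s = "\<lambda>N. \<Sum>n\<le>N. g (D n)"
    have "(\<Sum>n\<le>N. \<nu> (D n \<inter> K)) = Fin (?s N)" for N
      by (simp add: g[OF D'] sum_Fin)
    moreover have "isLub UNIV (range (\<lambda>N. \<Sum>n\<le>N. \<nu> (D n \<inter> K))) (\<nu> (\<Union>n. D n \<inter> K))"
      using D K(1) by (intro ext_measure_UN[OF \<nu>]) (auto simp: disjoint_family_on_def)
    moreover have "(\<Union>n. D n \<inter> K) = \<Union> (range D) \<inter> K"
      by auto
    ultimately have "isLub UNIV (Fin ` range ?s) (Fin (g (\<Union> (range D))))"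
      by (simp add: g[OF D(3)] image_image)
    then have "isLub UNIV (range ?s) (g (\<Union> (range D)))"
      by (simp add: isLub_Fin_image_iff)
    moreover have "incseq ?s"
      using g_nonneg[OF D'] by (auto intro: incseq_SucI)
    ultimately have "isLub UNIV (x' ` range ?s) (x' (g (\<Union> (range D))))"
      by (intro oc_functional_Lub[OF x'] up_directed_incseq)
    then have "isLub UNIV (range (\<lambda>N. \<Sum>n\<le>N. x' (g (D n)))) (x' (g (\<Union> (range D))))"
      by (simp add: image_image linear_sum[OF oc_functional_linear[OF x']])
    moreover have "0 \<le> (\<Sum>n\<le>N. x' (g (D n)))" for N
      by (intro sum_nonneg x'g D')
    ultimately have "(SUP N. ennreal (\<Sum>n\<le>N. x' (g (D n)))) = ennreal (x' (g (\<Union> (range D))))"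
      by (subst (asm) isLub_real_iff) (auto simp: image_image)
    moreover have "ennreal (\<Sum>n\<le>N. x' (g (D n))) = (\<Sum>n\<le>N. ennreal (x' (g (D n))))" for N
      by (rule sum_ennreal[symmetric]) (rule x'g[OF D'])
    moreover have "(\<lambda>N. \<Sum>n\<le>N. ennreal (x' (g (D n)))) \<longlonglongrightarrow> (SUP N. \<Sum>n\<le>N. ennreal (x' (g (D n))))"
      by (intro LIMSEQ_SUP incseq_SucI) simp
    ultimately show "(\<Sum>i. ennreal (x' (g (D i)))) = ennreal (x' (g (\<Union> (range D))))"
      using LIMSEQ_unique[OF summable_LIMSEQ'[of "\<lambda>n. ennreal (x' (g (D n)))"]] by simp
  qed
  moreover have "x' (g {}) = 0"
    using ext_measure_empty[OF \<nu>] linear_0[OF oc_functional_linear[OF x']]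
    by (simp add: g_def zero_ext_space_def)
  then have "positive (sets M) (\<lambda>A. ennreal (x' (g A)))"
    by (simp add: positive_def)
  ultimately have "emeasure N A = ennreal (x' (g A))" if "A \<in> sets M" for A
    unfolding N_def using that by (intro emeasure_measure_of_sigma sets.sigma_algebra_axioms)
  moreover have "g A = fin_part (\<nu> A)" if "A \<subseteq> K" for A
    using that by (simp add: g_def Int_absorb2)
  ultimately show thesis
    by (intro that[of N]) (simp_all add: N_def)
qed

section \<open>Order integrals of bounded functions\<close>

lemma elementary_approx_exists:
  fixes f :: "'a \<Rightarrow> real"
  assumes "f \<in> borel_measurable M"
  obtains \<phi> where "elementary_approx M \<phi> (\<lambda>x. ennreal (f x))"
proof -
  obtain g where g: "\<And>i::nat. simple_function M (g i)" "incseq g" "\<And>i x. g i x < top"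
      "\<And>x. (SUP i. g i x) = ennreal (f x)"
    using assms borel_measurable_implies_simple_function_sequence'[of "\<lambda>x. ennreal (f x)" M]
    by (metis measurable_compose_rev measurable_ennreal)
  have g_eq: "ennreal (enn2real (g n x)) = g n x" for n x
    using g(3) by simp
  have inc: "incseq (\<lambda>n. g n x)" for x
    using g(2) by (simp add: incseq_def le_fun_def)
  have "incseq (\<lambda>n. enn2real (g n x))" for x
    using inc g(3) by (auto simp: incseq_def intro: enn2real_mono)
  moreover have "(\<lambda>n. ennreal (enn2real (g n x))) \<longlonglongrightarrow> ennreal (f x)" for x
    using LIMSEQ_SUP[OF inc[of x]] by (simp add: g_eq g(4))
  moreover have "elementary_function M (\<lambda>x. enn2real (g n x))" for n
    using simple_function_compose1[OF g(1), of enn2real] by (simp add: elementary_function_def)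
  ultimately show thesis
    by (intro that[of "\<lambda>n x. enn2real (g n x)"]) (auto simp: elementary_approx_def)
qed

text \<open>The sum over level sets mirrors \<open>elementary_integral\<close>, so a functional can
  be applied to the vector integral term by term.\<close>

lemma nn_integral_simple_levels:
  fixes \<phi> :: "'a \<Rightarrow> real"
  assumes "simple_function M \<phi>"
  shows "(\<integral>\<^sup>+x. ennreal (\<phi> x) \<partial>M) =
    (\<Sum>r\<in>\<phi> ` space M. ennreal r * emeasure M (\<phi> -` {r} \<inter> space M))"
proof -
  have fin: "finite (\<phi> ` space M)" and sets: "\<phi> -` {r} \<inter> space M \<in> sets M" for r
    using assms by (auto simp: simple_functionD)
  have "ennreal (\<phi> x) = (\<Sum>r\<in>\<phi> ` space M. ennreal r * indicator (\<phi> -` {r} \<inter> space M) x)"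
    if "x \<in> space M" for x
  proof -
    have "(\<Sum>r\<in>\<phi> ` space M. ennreal r * indicator (\<phi> -` {r} \<inter> space M) x) =
        (\<Sum>r\<in>\<phi> ` space M. if r = \<phi> x then ennreal r else 0)"
      using that by (intro sum.cong) (auto simp: indicator_def)
    then show ?thesis
      using fin that by (simp add: sum.delta)
  qed
  then have "(\<integral>\<^sup>+x. ennreal (\<phi> x) \<partial>M) =
      (\<integral>\<^sup>+x. (\<Sum>r\<in>\<phi> ` space M. ennreal r * indicator (\<phi> -` {r} \<inter> space M) x) \<partial>M)"
    by (intro nn_integral_cong)
  also have "\<dots> = (\<Sum>r\<in>\<phi> ` space M. \<integral>\<^sup>+x. ennreal r * indicator (\<phi> -` {r} \<inter> space M) x \<partial>M)"
    using sets by (intro nn_integral_sum) auto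
  finally show ?thesis
    using sets by (simp add: nn_integral_cmult_indicator)
qed

text \<open>
  The family \<open>N\<close> need only extend the scalar measures \<open>x' \<circ> \<nu>\<close> from the measurable subsets of \<open>K\<close>,
  so the lemma applies to any measure that is finite at \<open>K\<close>, and likewise to Riesz measures that
  are infinite outside \<open>K\<close>.
\<close>

lemma order_nn_integral_functional:
  fixes \<nu> :: "'a set \<Rightarrow> 'e::ordered_real_vector ext_space"
  assumes mc: "monotone_complete TYPE('e)" and normal: "normal_ordered_space TYPE('e)"
    and f: "f \<in> borel_measurable M" "\<And>x. 0 \<le> f x" "\<And>x. f x \<le> B" "\<And>x. x \<notin> K \<Longrightarrow> f x = 0"
    and K: "K \<in> sets M"
    and \<nu>: "\<And>A. A \<in> sets M \<Longrightarrow> A \<subseteq> K \<Longrightarrow> \<nu> A = Fin (v A) \<and> 0 \<le> v A"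
    and N: "\<And>x'. x' \<in> positive_oc_functionals \<Longrightarrow> sets (N x') = sets M"
      "\<And>x' A. x' \<in> positive_oc_functionals \<Longrightarrow> A \<in> sets M \<Longrightarrow> A \<subseteq> K \<Longrightarrow>
        emeasure (N x') A = ennreal (x' (v A))"
  obtains e where "order_nn_integral M \<nu> (\<lambda>x. ennreal (f x)) = Fin e"
    "\<And>x'. x' \<in> positive_oc_functionals \<Longrightarrow> 0 \<le> x' e"
    "\<And>x'. x' \<in> positive_oc_functionals \<Longrightarrow> ennreal (x' e) = (\<integral>\<^sup>+x. ennreal (f x) \<partial>N x')"
proof -
  have spaceN: "space (N x') = space M" if "x' \<in> positive_oc_functionals" for x'
    using N(1)[OF that] by (rule sets_eq_imp_space_eq)
  have elem: "\<exists>a. elementary_integral M \<nu> \<phi> = Fin a \<and> (\<forall>x'\<in>positive_oc_functionals.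
      0 \<le> x' a \<and> ennreal (x' a) = (\<integral>\<^sup>+x. ennreal (\<phi> x) \<partial>N x'))"
    if \<phi>: "elementary_function M \<phi>" "\<And>x. x \<in> space M \<Longrightarrow> ennreal (\<phi> x) \<le> ennreal (f x)" for \<phi>
  proof -
    let ?A = "\<lambda>r. \<phi> -` {r} \<inter> space M"
    have nonneg: "0 \<le> r" if "r \<in> \<phi> ` space M" for r
      using \<phi>(1) that by (auto simp: elementary_function_def)
    have A: "?A r \<in> sets M" for r
      using \<phi>(1) by (auto simp: elementary_function_def simple_functionD)
    \<comment> \<open>Nonzero levels force \<open>f\<close> to be nonzero, hence stay in
      \<open>K\<close>. The zero level may leave \<open>K\<close> and have infinite measure, but
      contributes 0 by the convention for \<open>ext_scale\<close>.\<close>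
    have AK: "?A r \<subseteq> K" if r: "r \<in> \<phi> ` space M" "r \<noteq> 0" for r
    proof
      fix x assume x: "x \<in> ?A r"
      then have "0 < \<phi> x"
        using nonneg[OF r(1)] r(2) by auto
      then have "f x \<noteq> 0"
        using \<phi>(2)[of x] x by auto
      with f(4) show "x \<in> K"
        by blast
    qed
    define a where "a = (\<Sum>r\<in>\<phi> ` space M. r *\<^sub>R v (?A r))"
    have "elementary_integral M \<nu> \<phi> = (\<Sum>r\<in>\<phi> ` space M. Fin (r *\<^sub>R v (?A r)))"
      unfolding elementary_integral_def
    proof (intro sum.cong refl)
      fix r assume r: "r \<in> \<phi> ` space M"
      show "ext_scale r (\<nu> (?A r)) = Fin (r *\<^sub>R v (?A r))"
        using \<nu>[OF A AK[OF r]] by (cases "r = 0") simp_all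
    qed
    then have "elementary_integral M \<nu> \<phi> = Fin a"
      by (simp add: sum_Fin a_def)
    moreover have "0 \<le> x' a \<and> ennreal (x' a) = (\<integral>\<^sup>+x. ennreal (\<phi> x) \<partial>N x')"
      if x': "x' \<in> positive_oc_functionals" for x'
    proof -
      have x'a: "x' a = (\<Sum>r\<in>\<phi> ` space M. r * x' (v (?A r)))"
        by (simp add: a_def linear_sum[OF oc_functional_linear[OF x']]
            linear_scale[OF oc_functional_linear[OF x']])
      have level: "0 \<le> r * x' (v (?A r)) \<and>
          ennreal (r * x' (v (?A r))) = ennreal r * emeasure (N x') (?A r)"
        if r: "r \<in> \<phi> ` space M" for r
      proof (cases "r = 0")
        case False
        have "0 \<le> x' (v (?A r))"
          using \<nu>[OF A AK[OF r False]] by (intro oc_functional_nonneg[OF x']) simp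
        then show ?thesis
          using nonneg[OF r] N(2)[OF x' A AK[OF r False]] by (simp add: ennreal_mult)
      qed simp
      have "simple_function (N x') \<phi>"
        using \<phi>(1) N(1)[OF x'] spaceN[OF x'] by (simp add: elementary_function_def simple_function_def)
      then have "(\<integral>\<^sup>+x. ennreal (\<phi> x) \<partial>N x') = (\<Sum>r\<in>\<phi> ` space M. ennreal r * emeasure (N x') (?A r))"
        using nn_integral_simple_levels[of "N x'" \<phi>] by (simp add: spaceN[OF x'])
      also have "\<dots> = (\<Sum>r\<in>\<phi> ` space M. ennreal (r * x' (v (?A r))))"
        using level by (intro sum.cong) auto
      also have "\<dots> = ennreal (x' a)"
        unfolding x'a using level by (intro sum_ennreal) auto
      finally show ?thesis
        unfolding x'a using level by (auto intro: sum_nonneg)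
    qed
    ultimately show ?thesis
      by blast
  qed
  \<comment> \<open>This is the vector bound that monotone completeness requires for the elementary
    integrals; it comes from \<open>f\<close> being at most \<open>B\<close> on \<open>K\<close> and
    0 elsewhere.\<close>
  define u where "u = B *\<^sub>R v K"
  have u: "0 \<le> x' u \<and> (\<integral>\<^sup>+x. ennreal (f x) \<partial>N x') \<le> ennreal (x' u)"
    if x': "x' \<in> positive_oc_functionals" for x'
  proof -
    have B: "0 \<le> B"
      using f(2,3) by (meson order_trans)
    have vK: "0 \<le> x' (v K)"
      using \<nu>[OF K] by (intro oc_functional_nonneg[OF x']) simp
    have "(\<integral>\<^sup>+x. ennreal (f x) \<partial>N x') \<le> (\<integral>\<^sup>+x. ennreal B * indicator K x \<partial>N x')"
      using f(3,4) by (intro nn_integral_mono) (auto simp: indicator_def ennreal_leI)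
    also have "\<dots> = ennreal (x' u)"
      using K N(1)[OF x'] N(2)[OF x' K] B vK
      by (simp add: nn_integral_cmult_indicator u_def linear_scale[OF oc_functional_linear[OF x']] ennreal_mult)
    finally show ?thesis
      using B vK by (simp add: u_def linear_scale[OF oc_functional_linear[OF x']])
  qed
  have approx: "\<exists>e. isLub UNIV (range (\<lambda>n. elementary_integral M \<nu> (\<phi> n))) (Fin e) \<and>
      (\<forall>x'\<in>positive_oc_functionals. 0 \<le> x' e \<and> ennreal (x' e) = (\<integral>\<^sup>+x. ennreal (f x) \<partial>N x'))"
    if \<phi>: "elementary_approx M \<phi> (\<lambda>x. ennreal (f x))" for \<phi>
  proof -
    have inc: "incseq (\<lambda>n. ennreal (\<phi> n x))" and lim: "(\<lambda>n. ennreal (\<phi> n x)) \<longlonglongrightarrow> ennreal (f x)"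
      if "x \<in> space M" for x
      using \<phi> that by (auto simp: elementary_approx_def incseq_def intro: ennreal_leI)
    have sup: "(SUP n. ennreal (\<phi> n x)) = ennreal (f x)" if "x \<in> space M" for x
      using LIMSEQ_unique[OF LIMSEQ_SUP[OF inc[OF that]] lim[OF that]] .
    have le: "ennreal (\<phi> n x) \<le> ennreal (f x)" if "x \<in> space M" for n x
      unfolding sup[OF that, symmetric] by (rule SUP_upper) simp
    have el: "elementary_function M (\<phi> n)" for n
      using \<phi> by (simp add: elementary_approx_def)
    have "\<forall>n. \<exists>a. elementary_integral M \<nu> (\<phi> n) = Fin a \<and> (\<forall>x'\<in>positive_oc_functionals.
        0 \<le> x' a \<and> ennreal (x' a) = (\<integral>\<^sup>+x. ennreal (\<phi> n x) \<partial>N x'))"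
      using elem[OF el le] by blast
    then obtain a where a: "\<And>n. elementary_integral M \<nu> (\<phi> n) = Fin (a n)"
        "\<And>n x'. x' \<in> positive_oc_functionals \<Longrightarrow> 0 \<le> x' (a n)"
        "\<And>n x'. x' \<in> positive_oc_functionals \<Longrightarrow> ennreal (x' (a n)) = (\<integral>\<^sup>+x. ennreal (\<phi> n x) \<partial>N x')"
      by metis
    have "a m \<le> a n" if "m \<le> n" for m n
      unfolding normal_le_iff[OF normal]
    proof
      fix x' :: "'e \<Rightarrow> real" assume x': "x' \<in> positive_oc_functionals"
      have "(\<integral>\<^sup>+x. ennreal (\<phi> m x) \<partial>N x') \<le> (\<integral>\<^sup>+x. ennreal (\<phi> n x) \<partial>N x')"
        using incseqD[OF inc that] by (intro nn_integral_mono) (simp add: spaceN[OF x'])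
      then have "ennreal (x' (a m)) \<le> ennreal (x' (a n))"
        by (simp add: a(3)[OF x'])
      then show "x' (a m) \<le> x' (a n)"
        by (simp add: a(2)[OF x'])
    qed
    then have dir: "up_directed (range a)"
      by (intro up_directed_incseq) (simp add: incseq_def)
    have "a n \<le> u" for n
      unfolding normal_le_iff[OF normal]
    proof
      fix x' :: "'e \<Rightarrow> real" assume x': "x' \<in> positive_oc_functionals"
      have "(\<integral>\<^sup>+x. ennreal (\<phi> n x) \<partial>N x') \<le> (\<integral>\<^sup>+x. ennreal (f x) \<partial>N x')"
        by (intro nn_integral_mono le) (simp add: spaceN[OF x'])
      then have "ennreal (x' (a n)) \<le> ennreal (x' u)"
        using u[OF x'] by (auto simp: a(3)[OF x'] intro: order_trans)
      then show "x' (a n) \<le> x' u"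
        using u[OF x'] by simp
    qed
    then obtain e where e: "isLub UNIV (range a) e"
      using monotone_complete_Lub[OF mc dir, of u] by blast
    have "0 \<le> x' e \<and> ennreal (x' e) = (\<integral>\<^sup>+x. ennreal (f x) \<partial>N x')"
      if x': "x' \<in> positive_oc_functionals" for x'
    proof -
      have "isLub UNIV (x' ` range a) (x' e)"
        by (rule oc_functional_Lub[OF x' dir e])
      then have *: "0 \<le> x' e" "(SUP n. ennreal (x' (a n))) = ennreal (x' e)"
        using a(2)[OF x'] by (subst (asm) isLub_real_iff; auto simp: image_image)+
      have "(\<integral>\<^sup>+x. ennreal (f x) \<partial>N x') = (\<integral>\<^sup>+x. (SUP n. ennreal (\<phi> n x)) \<partial>N x')"
        by (intro nn_integral_cong) (simp add: spaceN[OF x'] sup)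
      also have "\<dots> = (SUP n. \<integral>\<^sup>+x. ennreal (\<phi> n x) \<partial>N x')"
      proof (rule nn_integral_monotone_convergence_SUP_AE)
        show "AE x in N x'. ennreal (\<phi> n x) \<le> ennreal (\<phi> (Suc n) x)" for n
          using incseq_SucD[OF inc] by (intro AE_I2) (simp add: spaceN[OF x'])
        have "\<phi> n \<in> borel_measurable M" for n
          using el[of n] by (simp add: elementary_function_def borel_measurable_simple_function)
        then show "(\<lambda>x. ennreal (\<phi> n x)) \<in> borel_measurable (N x')" for n
          using N(1)[OF x'] by (simp cong: measurable_cong_sets)
      qed
      finally show ?thesis
        using * by (simp add: a(3)[OF x'])
    qed
    moreover have "isLub UNIV (range (\<lambda>n. elementary_integral M \<nu> (\<phi> n))) (Fin e)"
      using e isLub_Fin_image_iff[of "range a" e] by (simp add: a(1) image_image)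
    ultimately show ?thesis
      by blast
  qed
  obtain \<phi>\<^sub>0 where \<phi>\<^sub>0: "elementary_approx M \<phi>\<^sub>0 (\<lambda>x. ennreal (f x))"
    using elementary_approx_exists[OF f(1)] .
  obtain e where e: "isLub UNIV (range (\<lambda>n. elementary_integral M \<nu> (\<phi>\<^sub>0 n))) (Fin e)"
      "\<And>x'. x' \<in> positive_oc_functionals \<Longrightarrow> 0 \<le> x' e"
      "\<And>x'. x' \<in> positive_oc_functionals \<Longrightarrow> ennreal (x' e) = (\<integral>\<^sup>+x. ennreal (f x) \<partial>N x')"
    using approx[OF \<phi>\<^sub>0] by blast
  \<comment> \<open>The description operator calls for independence of the approximating sequence.
    Any two sequences give vectors with the same scalar integrals as images, and normality
    identifies these vectors.\<close>
  have "order_nn_integral M \<nu> (\<lambda>x. ennreal (f x)) = Fin e"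
    unfolding order_nn_integral_def
  proof (rule the_equality)
    fix s assume "\<exists>\<phi>. elementary_approx M \<phi> (\<lambda>x. ennreal (f x)) \<and>
        isLub UNIV (range (\<lambda>n. elementary_integral M \<nu> (\<phi> n))) s"
    then obtain \<phi> where \<phi>: "elementary_approx M \<phi> (\<lambda>x. ennreal (f x))"
        "isLub UNIV (range (\<lambda>n. elementary_integral M \<nu> (\<phi> n))) s"
      by blast
    obtain d where d: "isLub UNIV (range (\<lambda>n. elementary_integral M \<nu> (\<phi> n))) (Fin d)"
        "\<And>x'. x' \<in> positive_oc_functionals \<Longrightarrow> 0 \<le> x' d"
        "\<And>x'. x' \<in> positive_oc_functionals \<Longrightarrow> ennreal (x' d) = (\<integral>\<^sup>+x. ennreal (f x) \<partial>N x')"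
      using approx[OF \<phi>(1)] by blast
    have "d = e"
      using d(2,3) e(2,3) by (intro normal_eqI[OF normal]) (metis ennreal_inj)
    then show "s = Fin e"
      using isLub_eqI[OF \<phi>(2) d(1)] by simp
  qed (use \<phi>\<^sub>0 e(1) in blast)
  then show thesis
    using e(2,3) by (rule that)
qed

section \<open>Regularity on subspaces\<close>

lemma inner_regular_at_subtopology:
  assumes "V \<subseteq> U"
  shows "inner_regular_at (subtopology X U) \<nu> V \<longleftrightarrow> inner_regular_at X \<nu> V"
proof -
  have "{\<nu> K |K. compactin (subtopology X U) K \<and> K \<subseteq> V} = {\<nu> K |K. compactin X K \<and> K \<subseteq> V}"
    using assms by (auto simp: compactin_subtopology)
  then show ?thesis
    by (simp add: inner_regular_at_def)
qed

lemma outer_regular_at_subtopology: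
  assumes "openin X U"
  shows "outer_regular_at (subtopology X U) \<nu> A \<longleftrightarrow>
    isGlb UNIV {\<nu> V |V. openin X V \<and> V \<subseteq> U \<and> A \<subseteq> V} (\<nu> A)"
  using assms by (simp add: outer_regular_at_def openin_open_subtopology conj_assoc)

lemma ext_measure_subtopology:
  assumes "ext_measure (borel_of X) \<nu>" "openin X U"
  shows "ext_measure (borel_of (subtopology X U)) \<nu>"
  using assms(1) unfolding ext_measure_def sets_borel_of_open_subtopology[OF assms(2)] by auto

lemma borel_ext_measure_subtopology:
  assumes "borel_ext_measure X \<nu>" "openin X U"
  shows "borel_ext_measure (subtopology X U) \<nu>"
  using assms ext_measure_subtopology by (auto simp: borel_ext_measure_def compactin_subtopology)

text \<open>For \<open>A \<subseteq> U\<close>, an open \<open>V\<close> around \<open>A\<close> can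
  be replaced by \<open>V \<inter> U\<close>, which has no larger measure, so the infimum over open
  subsets of \<open>U\<close> is the same.\<close>

lemma regular_borel_measure_subtopology:
  assumes \<nu>: "regular_borel_measure X \<nu>" and U: "openin X U"
  shows "regular_borel_measure (subtopology X U) \<nu>"
  unfolding regular_borel_measure_def
proof (intro conjI allI impI ballI)
  have b: "borel_ext_measure X \<nu>"
    using \<nu> by (simp add: regular_borel_measure_def)
  then have m: "ext_measure (borel_of X) \<nu>"
    by (simp add: borel_ext_measure_def)
  show "borel_ext_measure (subtopology X U) \<nu>"
    by (rule borel_ext_measure_subtopology[OF b U])
  show "inner_regular_at (subtopology X U) \<nu> V" if "openin (subtopology X U) V" for V
    using that \<nu> U by (simp add: inner_regular_at_subtopology openin_open_subtopology regular_borel_measure_def)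
  fix A assume "A \<in> sets (borel_of (subtopology X U))"
  then have A: "A \<in> sets (borel_of X)" "A \<subseteq> U"
    by (simp_all add: sets_borel_of_open_subtopology[OF U])
  have glb: "isGlb UNIV {\<nu> V |V. openin X V \<and> A \<subseteq> V} (\<nu> A)"
    using \<nu> A(1) by (simp add: regular_borel_measure_def outer_regular_at_def)
  show "outer_regular_at (subtopology X U) \<nu> A"
    unfolding outer_regular_at_subtopology[OF U] isGlb_iff
  proof (intro conjI ballI allI impI)
    show "\<nu> A \<le> x" if "x \<in> {\<nu> V |V. openin X V \<and> V \<subseteq> U \<and> A \<subseteq> V}" for x
      using that by (intro isGlb_lower[OF glb]) auto
    fix u assume u: "\<forall>x\<in>{\<nu> V |V. openin X V \<and> V \<subseteq> U \<and> A \<subseteq> V}. u \<le> x"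
    have "u \<le> \<nu> V" if V: "openin X V" "A \<subseteq> V" for V
    proof -
      have "u \<le> \<nu> (V \<inter> U)"
        using u V U A(2) by blast
      also have "\<dots> \<le> \<nu> V"
        using V U by (intro ext_measure_mono[OF m] openin_borel_of) auto
      finally show ?thesis .
    qed
    then show "u \<le> \<nu> A"
      by (intro isGlb_greatest[OF glb]) auto
  qed
qed

section \<open>The representing measure\<close>

text \<open>
  Meaningful only for Borel sets inside a compact set. At other sets the scalar measures may be
  infinite, and no such vector need exist.
\<close>

definition oc_value :: "'a topology \<Rightarrow> (('a \<Rightarrow> real) \<Rightarrow> 'e::ordered_real_vector) \<Rightarrow> 'a set \<Rightarrow> 'e" where
  "oc_value X \<pi> A = (SOME v. \<forall>x'\<in>positive_oc_functionals. 0 \<le> x' v \<and>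
     ennreal (x' v) = emeasure (riesz_measure X (\<lambda>f. x' (\<pi> f))) A)"

text \<open>Weak inner regularity is made the rule of extension. Each \<open>A \<inter> K\<close> is
  inside a compact set, so it has a vector, and the supremum exists because unions of compact sets
  direct the family.\<close>

definition representing_measure ::
  "'a topology \<Rightarrow> (('a \<Rightarrow> real) \<Rightarrow> 'e::ordered_real_vector) \<Rightarrow> 'a set \<Rightarrow> 'e ext_space" where
  "representing_measure X \<pi> A =
     (SOME s. isLub UNIV ((\<lambda>K. Fin (oc_value X \<pi> (A \<inter> K))) ` {K. compactin X K}) s)"

locale normal_riesz = locally_compact_Hausdorff X for X :: "'a topology" +
  fixes \<pi> :: "('a \<Rightarrow> real) \<Rightarrow> 'e::ordered_real_vector"
  assumes mc: "monotone_complete TYPE('e)" and normal: "normal_ordered_space TYPE('e)"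
    and positive: "positive_operator_Cc X \<pi>"
begin

abbreviation scalar :: "('e \<Rightarrow> real) \<Rightarrow> 'a measure" where
  "scalar x' \<equiv> riesz_measure X (\<lambda>f. x' (\<pi> f))"

lemma riesz_scalar: "x' \<in> positive_oc_functionals \<Longrightarrow> riesz X (\<lambda>f. x' (\<pi> f))"
  by unfold_locales (rule oc_functional_positive_operator[OF positive])

lemma sets_scalar: "x' \<in> positive_oc_functionals \<Longrightarrow> sets (scalar x') = sets (borel_of X)"
  by (rule riesz.sets_riesz_measure[OF riesz_scalar])

section \<open>Borel sets inside compact sets and their vectors\<close>

definition bounded_borel :: "'a set \<Rightarrow> bool" where
  "bounded_borel A \<longleftrightarrow> A \<in> sets (borel_of X) \<and> (\<exists>K. compactin X K \<and> A \<subseteq> K)"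

lemma bounded_borel_Int: "A \<in> sets (borel_of X) \<Longrightarrow> compactin X K \<Longrightarrow> bounded_borel (A \<inter> K)"
  using compactin_borel_of by (auto simp: bounded_borel_def)

lemma bounded_borel_subset:
  "bounded_borel B \<Longrightarrow> A \<in> sets (borel_of X) \<Longrightarrow> A \<subseteq> B \<Longrightarrow> bounded_borel A"
  by (auto simp: bounded_borel_def)

lemma bounded_borel_compact: "compactin X K \<Longrightarrow> bounded_borel K"
  using compactin_borel_of by (auto simp: bounded_borel_def)

lemma bounded_borel_relatively_compact_open: "relatively_compact_open X U \<Longrightarrow> bounded_borel U"
  unfolding relatively_compact_open_def bounded_borel_def
  by (meson closure_of_subset openin_borel_of openin_subset)

lemma bounded_borel_neighbourhood:
  assumes "bounded_borel A"
  obtains U where "relatively_compact_open X U" "A \<subseteq> U"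
proof -
  obtain K where "compactin X K" "A \<subseteq> K"
    using assms by (auto simp: bounded_borel_def)
  then show thesis
    using compact_neighbourhood[of K] that by (metis order_trans relatively_compact_open_def)
qed

lemma bounded_borel_open: "bounded_borel V \<Longrightarrow> openin X V \<Longrightarrow> relatively_compact_open X V"
  unfolding bounded_borel_def relatively_compact_open_def
  by (meson closed_compactin closedin_closure_of closure_of_minimal compactin_closedin)

text \<open>A cutoff function \<open>u\<close> equal to 1 near the compact closure of
  \<open>V\<close> dominates all functions below \<open>V\<close>, so \<open>\<pi> u\<close> is the
  vector bound that completeness needs. Order continuity carries the resulting supremum to the
  scalar content of \<open>V\<close>.\<close>

lemma oc_value_open_exists:
  assumes V: "relatively_compact_open X V"
  shows "\<exists>v. \<forall>x'\<in>positive_oc_functionals. 0 \<le> x' v \<and> ennreal (x' v) = emeasure (scalar x') V"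
proof -
  have cl: "compactin X (X closure_of V)" and opV: "openin X V"
    using V by (auto simp: relatively_compact_open_def)
  obtain u N where u: "u \<in> Cc_below X (topspace X)" "openin X N" "X closure_of V \<subseteq> N" "\<And>x. x \<in> N \<Longrightarrow> u x = 1"
    by (rule cutoff_function[OF cl openin_topspace closure_of_subset_topspace]) blast
  note u' = Cc_belowD[OF u(1)]
  have uV: "u x = 1" if "x \<in> V" for x
    using that u(3,4) closure_of_subset[OF openin_subset[OF opV]] by blast
  have dir: "up_directed (\<pi> ` Cc_below X V)"
    by (rule positive_operator_below_directed[OF positive])
  have "\<pi> f \<le> \<pi> u" if f: "f \<in> Cc_below X V" for f
  proof (rule positive_operator_mono[OF positive Cc_belowD(1)[OF f] u'(1)])
    show "f x \<le> u x" for x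
      using uV[of x] u'(2)[of x] Cc_belowD(3)[OF f, of x] Cc_below_eq_0[OF f, of x] by (cases "x \<in> V") auto
  qed
  then obtain v where v: "isLub UNIV (\<pi> ` Cc_below X V) v"
    using monotone_complete_Lub[OF mc dir, of "\<pi> u"] by blast
  have "0 \<le> x' v \<and> ennreal (x' v) = emeasure (scalar x') V"
    if x': "x' \<in> positive_oc_functionals" for x'
  proof -
    have lub: "isLub UNIV (x' ` \<pi> ` Cc_below X V) (x' v)"
      by (rule oc_functional_Lub[OF x' dir v])
    have "0 \<le> x' v \<and> (SUP y\<in>x' ` \<pi> ` Cc_below X V. ennreal y) = ennreal (x' v)"
    proof (subst isLub_real_iff[symmetric])
      show "x' ` \<pi> ` Cc_below X V \<noteq> {}"
        using Cc_below_0 by blast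
      show "0 \<le> y" if "y \<in> x' ` \<pi> ` Cc_below X V" for y
        using that oc_functional_nonneg[OF x'] positive_operator_below_nonneg[OF positive] by blast
    qed (rule lub)
    then show ?thesis
      using riesz.emeasure_riesz_open[OF riesz_scalar[OF x'] opV] by (simp add: image_image)
  qed
  then show ?thesis
    by blast
qed

lemma scalar_le_imp_le:
  fixes a b :: 'e
  assumes "\<And>x'. x' \<in> positive_oc_functionals \<Longrightarrow> ennreal (x' a) \<le> ennreal (x' b)"
    and "\<And>x'. x' \<in> positive_oc_functionals \<Longrightarrow> 0 \<le> x' b"
  shows "a \<le> b"
  using assms by (simp add: normal_le_iff[OF normal])

text \<open>The open neighbourhoods are confined to \<open>U\<close> because vectors are available
  only for open sets inside compact sets. Intersecting with \<open>U\<close> does not raise the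
  measure, so the infimum is unchanged.\<close>

lemma scalar_outer_regular:
  assumes x': "x' \<in> positive_oc_functionals" and A: "A \<in> sets (borel_of X)" and U: "openin X U" "A \<subseteq> U"
  shows "(INF V\<in>{V. openin X V \<and> V \<subseteq> U \<and> A \<subseteq> V}. emeasure (scalar x') V) = emeasure (scalar x') A"
proof (rule antisym)
  show "emeasure (scalar x') A \<le> (INF V\<in>{V. openin X V \<and> V \<subseteq> U \<and> A \<subseteq> V}. emeasure (scalar x') V)"
    by (intro INF_greatest emeasure_mono) (auto simp: sets_scalar[OF x'] openin_borel_of)
  show "(INF V\<in>{V. openin X V \<and> V \<subseteq> U \<and> A \<subseteq> V}. emeasure (scalar x') V) \<le> emeasure (scalar x') A"
    unfolding riesz.emeasure_riesz_outer_regular[OF riesz_scalar[OF x'] A]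
  proof (rule INF_greatest)
    fix V assume "V \<in> {V. openin X V \<and> A \<subseteq> V}"
    then have V: "openin X V" "A \<subseteq> V"
      by auto
    have "(INF V\<in>{V. openin X V \<and> V \<subseteq> U \<and> A \<subseteq> V}. emeasure (scalar x') V) \<le> emeasure (scalar x') (V \<inter> U)"
      using V U by (intro INF_lower) auto
    also have "\<dots> \<le> emeasure (scalar x') V"
      using V by (intro emeasure_mono) (auto simp: sets_scalar[OF x'] openin_borel_of)
    finally show "(INF V\<in>{V. openin X V \<and> V \<subseteq> U \<and> A \<subseteq> V}. emeasure (scalar x') V) \<le> emeasure (scalar x') V" .
  qed
qed

text \<open>The vectors of the open sets between \<open>A\<close> and \<open>U\<close> form a
  downward directed family, by intersection, with lower bound 0. Its infimum works for all
  functionals at once: order continuity and outer regularity give the image under each.\<close>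

lemma oc_value_exists:
  assumes A: "bounded_borel A"
  shows "\<exists>v. \<forall>x'\<in>positive_oc_functionals. 0 \<le> x' v \<and> ennreal (x' v) = emeasure (scalar x') A"
proof -
  obtain U where U: "relatively_compact_open X U" "A \<subseteq> U"
    using bounded_borel_neighbourhood[OF A] .
  have opU: "openin X U"
    using U(1) by (simp add: relatively_compact_open_def)
  let ?V = "{V. openin X V \<and> V \<subseteq> U \<and> A \<subseteq> V}"
  have "\<forall>V\<in>?V. \<exists>v. \<forall>x'\<in>positive_oc_functionals. 0 \<le> x' v \<and> ennreal (x' v) = emeasure (scalar x') V"
  proof
    fix V assume "V \<in> ?V"
    then have V: "openin X V" "V \<subseteq> U"
      by auto
    have "bounded_borel V"
      by (rule bounded_borel_subset[OF bounded_borel_relatively_compact_open[OF U(1)] openin_borel_of[OF V(1)] V(2)])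
    then show "\<exists>v. \<forall>x'\<in>positive_oc_functionals. 0 \<le> x' v \<and> ennreal (x' v) = emeasure (scalar x') V"
      by (intro oc_value_open_exists bounded_borel_open V(1))
  qed
  from bchoice[OF this] obtain w where w: "\<And>V x'. V \<in> ?V \<Longrightarrow> x' \<in> positive_oc_functionals \<Longrightarrow>
      0 \<le> x' (w V) \<and> ennreal (x' (w V)) = emeasure (scalar x') V"
    by blast
  have mono: "w V \<le> w W" if "V \<in> ?V" "W \<in> ?V" "V \<subseteq> W" for V W
    using that w by (intro scalar_le_imp_le)
      (auto simp: sets_scalar openin_borel_of intro!: emeasure_mono)
  have dir: "down_directed (w ` ?V)"
    unfolding down_directed_def
  proof (intro conjI ballI)
    show "w ` ?V \<noteq> {}"
      using opU U(2) by blast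
    fix a b assume "a \<in> w ` ?V" "b \<in> w ` ?V"
    then obtain V W where VW: "V \<in> ?V" "W \<in> ?V" "a = w V" "b = w W"
      by blast
    then have VW': "V \<inter> W \<in> ?V"
      by auto
    show "\<exists>z\<in>w ` ?V. z \<le> a \<and> z \<le> b"
      unfolding VW(3,4)
      by (intro bexI[of _ "w (V \<inter> W)"] conjI mono VW(1,2) VW' imageI Int_lower1 Int_lower2)
  qed
  have "0 \<le> w V" if "V \<in> ?V" for V
    using w[OF that] by (intro normal_nonnegI[OF normal]) blast
  then obtain v where v: "isGlb UNIV (w ` ?V) v"
    using monotone_complete_Glb[OF mc dir, of 0] by blast
  have "0 \<le> x' v \<and> ennreal (x' v) = emeasure (scalar x') A"
    if x': "x' \<in> positive_oc_functionals" for x'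
  proof -
    have glb: "isGlb UNIV (x' ` w ` ?V) (x' v)"
      by (rule oc_functional_Glb[OF x' dir v])
    have "0 \<le> x' v \<and> (INF y\<in>x' ` w ` ?V. ennreal y) = ennreal (x' v)"
    proof (subst isGlb_real_iff[symmetric])
      show "x' ` w ` ?V \<noteq> {}"
        using opU U(2) by blast
      show "0 \<le> y" if "y \<in> x' ` w ` ?V" for y
        using that w[OF _ x'] by blast
    qed (rule glb)
    moreover have "(INF V\<in>?V. ennreal (x' (w V))) = (INF V\<in>?V. emeasure (scalar x') V)"
      using w[OF _ x'] by (intro INF_cong refl) blast
    ultimately show ?thesis
      using scalar_outer_regular[OF x' _ opU U(2)] A by (simp add: image_image bounded_borel_def)
  qed
  then show ?thesis
    by blast
qed

lemma oc_value:
  assumes "bounded_borel A" "x' \<in> positive_oc_functionals"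
  shows "0 \<le> x' (oc_value X \<pi> A)" "ennreal (x' (oc_value X \<pi> A)) = emeasure (scalar x') A"
  using someI_ex[OF oc_value_exists[OF assms(1)]] assms(2) unfolding oc_value_def by blast+

lemma oc_value_mono:
  assumes "bounded_borel A" "bounded_borel B" "A \<subseteq> B"
  shows "oc_value X \<pi> A \<le> oc_value X \<pi> B"
  using assms
  by (intro scalar_le_imp_le)
    (auto simp: oc_value sets_scalar bounded_borel_def[of B] intro!: emeasure_mono)

lemma oc_value_nonneg: "bounded_borel A \<Longrightarrow> 0 \<le> oc_value X \<pi> A"
  by (intro normal_nonnegI[OF normal] oc_value)

lemma oc_value_outer_regular:
  assumes A: "A \<in> sets (borel_of X)" and U: "relatively_compact_open X U" "A \<subseteq> U"
  shows "isGlb UNIV (oc_value X \<pi> ` {V. openin X V \<and> V \<subseteq> U \<and> A \<subseteq> V}) (oc_value X \<pi> A)"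
proof (rule normal_GlbI[OF normal])
  fix x' :: "'e \<Rightarrow> real" assume x': "x' \<in> positive_oc_functionals"
  let ?V = "{V. openin X V \<and> V \<subseteq> U \<and> A \<subseteq> V}"
  have opU: "openin X U" and bU: "bounded_borel U"
    using U(1) by (simp_all add: relatively_compact_open_def bounded_borel_relatively_compact_open)
  have bA: "bounded_borel A"
    by (rule bounded_borel_subset[OF bU A U(2)])
  have bV: "bounded_borel V" if "V \<in> ?V" for V
    using that by (intro bounded_borel_subset[OF bU]) (auto simp: openin_borel_of)
  have "(INF V\<in>?V. ennreal (x' (oc_value X \<pi> V))) = (INF V\<in>?V. emeasure (scalar x') V)"
    using oc_value(2)[OF bV x'] by (intro INF_cong refl)
  then have inf: "(INF V\<in>?V. ennreal (x' (oc_value X \<pi> V))) = ennreal (x' (oc_value X \<pi> A))"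
    using scalar_outer_regular[OF x' A opU U(2)] by (simp add: oc_value(2)[OF bA x'])
  have ne: "x' ` oc_value X \<pi> ` ?V \<noteq> {}"
    using opU U(2) by blast
  show "isGlb UNIV (x' ` oc_value X \<pi> ` ?V) (x' (oc_value X \<pi> A))"
    using inf oc_value(1)[OF bV x'] oc_value(1)[OF bA x']
    by (subst isGlb_real_iff[OF ne]) (auto simp: image_image)
qed

text \<open>The images of these vectors are values of scalar measures, so the supremum formula holds
  under each functional, and \<open>normal_LubI\<close> lifts it.\<close>

lemma oc_value_UN:
  fixes D :: "nat \<Rightarrow> 'a set"
  assumes D: "\<And>n. D n \<in> sets (borel_of X)" "disjoint_family D" and b: "bounded_borel (\<Union>n. D n)"
  shows "isLub UNIV (range (\<lambda>N. \<Sum>n\<le>N. oc_value X \<pi> (D n))) (oc_value X \<pi> (\<Union>n. D n))"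
proof (rule normal_LubI[OF normal])
  fix x' :: "'e \<Rightarrow> real" assume x': "x' \<in> positive_oc_functionals"
  have bD: "bounded_borel (D n)" for n
    by (rule bounded_borel_subset[OF b D(1)]) auto
  have x'sum: "x' (\<Sum>n\<le>N. oc_value X \<pi> (D n)) = (\<Sum>n\<le>N. x' (oc_value X \<pi> (D n)))" for N
    by (rule linear_sum[OF oc_functional_linear[OF x']])
  have "ennreal (\<Sum>n\<le>N. x' (oc_value X \<pi> (D n))) = (\<Sum>n\<le>N. emeasure (scalar x') (D n))" for N
    using oc_value[OF bD x'] by (subst sum_ennreal[symmetric]) auto
  moreover have "(SUP N. \<Sum>n\<le>N. emeasure (scalar x') (D n)) = emeasure (scalar x') (\<Union>n. D n)"
  proof -
    have "(\<lambda>N. \<Sum>n\<le>N. emeasure (scalar x') (D n)) \<longlonglongrightarrow> (SUP N. \<Sum>n\<le>N. emeasure (scalar x') (D n))"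
      by (intro LIMSEQ_SUP incseq_SucI) simp
    then have "(SUP N. \<Sum>n\<le>N. emeasure (scalar x') (D n)) = (\<Sum>n. emeasure (scalar x') (D n))"
      using LIMSEQ_unique summable_LIMSEQ'[of "\<lambda>n. emeasure (scalar x') (D n)"] by blast
    also have "\<dots> = emeasure (scalar x') (\<Union>n. D n)"
      using D by (intro suminf_emeasure) (auto simp: sets_scalar[OF x'])
    finally show ?thesis .
  qed
  ultimately have "(SUP N. ennreal (\<Sum>n\<le>N. x' (oc_value X \<pi> (D n)))) = ennreal (x' (oc_value X \<pi> (\<Union>n. D n)))"
    by (simp add: oc_value(2)[OF b x'])
  then show "isLub UNIV (x' ` range (\<lambda>N. \<Sum>n\<le>N. oc_value X \<pi> (D n))) (x' (oc_value X \<pi> (\<Union>n. D n)))"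
    using oc_value(1)[OF b x'] oc_value(1)[OF bD x']
    by (subst isLub_real_iff) (auto simp: image_image x'sum intro: sum_nonneg)
qed

section \<open>The measure on all Borel sets\<close>

abbreviation \<mu> :: "'a set \<Rightarrow> 'e ext_space" where
  "\<mu> \<equiv> representing_measure X \<pi>"

lemma \<mu>_Lub:
  assumes A: "A \<in> sets (borel_of X)"
  shows "isLub UNIV ((\<lambda>K. Fin (oc_value X \<pi> (A \<inter> K))) ` {K. compactin X K}) (\<mu> A)"
proof -
  have "up_directed ((\<lambda>K. Fin (oc_value X \<pi> (A \<inter> K))) ` {K. compactin X K})"
    unfolding up_directed_def
  proof (intro conjI ballI)
    show "(\<lambda>K. Fin (oc_value X \<pi> (A \<inter> K))) ` {K. compactin X K} \<noteq> {}"
      using compactin_empty by blast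
    fix a b assume "a \<in> (\<lambda>K. Fin (oc_value X \<pi> (A \<inter> K))) ` {K. compactin X K}"
      "b \<in> (\<lambda>K. Fin (oc_value X \<pi> (A \<inter> K))) ` {K. compactin X K}"
    then obtain K L where KL: "compactin X K" "compactin X L"
        "a = Fin (oc_value X \<pi> (A \<inter> K))" "b = Fin (oc_value X \<pi> (A \<inter> L))"
      by blast
    have "a \<le> Fin (oc_value X \<pi> (A \<inter> (K \<union> L)))" "b \<le> Fin (oc_value X \<pi> (A \<inter> (K \<union> L)))"
      using KL by (auto intro!: oc_value_mono bounded_borel_Int A compactin_Un)
    with compactin_Un[OF KL(1,2)]
    show "\<exists>z\<in>(\<lambda>K. Fin (oc_value X \<pi> (A \<inter> K))) ` {K. compactin X K}. a \<le> z \<and> b \<le> z"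
      by blast
  qed
  then have "\<exists>s. isLub UNIV ((\<lambda>K. Fin (oc_value X \<pi> (A \<inter> K))) ` {K. compactin X K}) s"
    using ext_directed_Lub[OF mc] by metis
  then show ?thesis
    unfolding representing_measure_def by (rule someI_ex)
qed

lemma \<mu>_bounded:
  assumes A: "bounded_borel A"
  shows "\<mu> A = Fin (oc_value X \<pi> A)"
proof -
  obtain L where L: "compactin X L" "A \<subseteq> L"
    using A by (auto simp: bounded_borel_def)
  have A': "A \<in> sets (borel_of X)"
    using A by (simp add: bounded_borel_def)
  have "Fin (oc_value X \<pi> (A \<inter> K)) \<le> Fin (oc_value X \<pi> A)" if "compactin X K" for K
    using that by (simp add: oc_value_mono A bounded_borel_Int[OF A'])
  moreover have "A \<inter> L = A"
    using L(2) by blast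
  ultimately have "isLub UNIV ((\<lambda>K. Fin (oc_value X \<pi> (A \<inter> K))) ` {K. compactin X K}) (Fin (oc_value X \<pi> A))"
    using L(1) unfolding isLub_iff by (auto dest!: bspec[of _ _ L])
  with \<mu>_Lub[OF A'] show ?thesis
    by (rule isLub_eqI)
qed

lemma \<mu>_nonneg:
  assumes "A \<in> sets (borel_of X)"
  shows "0 \<le> \<mu> A"
proof -
  have "0 \<le> Fin (oc_value X \<pi> (A \<inter> {}))"
    using oc_value_nonneg[OF bounded_borel_Int[OF assms compactin_empty]] by simp
  also have "\<dots> \<le> \<mu> A"
    by (intro isLub_upper[OF \<mu>_Lub[OF assms]] imageI) (simp add: compactin_empty)
  finally show ?thesis .
qed

text \<open>Both sides are iterated suprema over compact sets \<open>K\<close> and partial sums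
  \<open>N\<close>. For fixed \<open>K\<close>, \<open>whole\<close> gives additivity of the
  vectors; for fixed \<open>N\<close>, \<open>part\<close> moves the supremum over \<open>K\<close>
  through the finite sum. Comparing bounds exchanges the two, and infinite values require no
  separate treatment.\<close>

lemma \<mu>_ext_measure: "ext_measure (borel_of X) \<mu>"
  unfolding ext_measure_def
proof (intro conjI ballI allI impI)
  have "bounded_borel {}"
    by (rule bounded_borel_compact) simp
  moreover have "oc_value X \<pi> {} = 0"
  proof (rule normal_eqI[OF normal])
    fix x' :: "'e \<Rightarrow> real" assume x': "x' \<in> positive_oc_functionals"
    show "x' (oc_value X \<pi> {}) = x' 0"
      using oc_value[OF \<open>bounded_borel {}\<close> x'] linear_0[OF oc_functional_linear[OF x']] by simp
  qed
  ultimately show "\<mu> {} = 0"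
    by (simp add: \<mu>_bounded)
  fix D :: "nat \<Rightarrow> 'a set"
  assume "range D \<subseteq> sets (borel_of X) \<and> disjoint_family D"
  then have D: "\<And>n. D n \<in> sets (borel_of X)" "disjoint_family D"
    by auto
  have UD: "(\<Union>n. D n) \<in> sets (borel_of X)"
    using D(1) by auto
  have part: "isLub UNIV ((\<lambda>K. \<Sum>n\<le>N. Fin (oc_value X \<pi> (D n \<inter> K))) ` {K. compactin X K}) (\<Sum>n\<le>N. \<mu> (D n))" for N
  proof (rule ext_Lub_sum)
    fix K L assume KL: "K \<in> {K. compactin X K}" "L \<in> {K. compactin X K}"
    then show "\<exists>M\<in>{K. compactin X K}. \<forall>n. Fin (oc_value X \<pi> (D n \<inter> K)) \<le> Fin (oc_value X \<pi> (D n \<inter> M)) \<and>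
        Fin (oc_value X \<pi> (D n \<inter> L)) \<le> Fin (oc_value X \<pi> (D n \<inter> M))"
      by (intro bexI[of _ "K \<union> L"])
        (auto intro!: oc_value_mono bounded_borel_Int D(1) compactin_Un)
  qed (use D(1) in \<open>auto intro!: \<mu>_Lub intro: compactin_empty\<close>)
  have whole: "isLub UNIV (range (\<lambda>N. \<Sum>n\<le>N. Fin (oc_value X \<pi> (D n \<inter> K)))) (Fin (oc_value X \<pi> ((\<Union>n. D n) \<inter> K)))"
    if K: "compactin X K" for K
  proof -
    have DK: "(\<Union>n. D n) \<inter> K = (\<Union>n. D n \<inter> K)"
      by auto
    have "isLub UNIV (range (\<lambda>N. \<Sum>n\<le>N. oc_value X \<pi> (D n \<inter> K))) (oc_value X \<pi> ((\<Union>n. D n) \<inter> K))"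
      unfolding DK
    proof (rule oc_value_UN)
      show "D n \<inter> K \<in> sets (borel_of X)" for n
        by (intro sets.Int D(1) compactin_borel_of K)
      show "disjoint_family (\<lambda>n. D n \<inter> K)"
        using D(2) by (auto simp: disjoint_family_on_def)
      show "bounded_borel (\<Union>n. D n \<inter> K)"
        unfolding DK[symmetric] by (rule bounded_borel_Int[OF UD K])
    qed
    then show ?thesis
      using isLub_Fin_image_iff[of "range (\<lambda>N. \<Sum>n\<le>N. oc_value X \<pi> (D n \<inter> K))"]
      by (simp add: sum_Fin image_image)
  qed
  show "isLub UNIV (range (\<lambda>N. \<Sum>n\<le>N. \<mu> (D n))) (\<mu> (\<Union>n. D n))"
    unfolding isLub_iff[of "range (\<lambda>N. \<Sum>n\<le>N. \<mu> (D n))"]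
  proof (intro conjI ballI allI impI)
    fix y assume "y \<in> range (\<lambda>N. \<Sum>n\<le>N. \<mu> (D n))"
    then obtain N where y: "y = (\<Sum>n\<le>N. \<mu> (D n))"
      by blast
    have "(\<Sum>n\<le>N. Fin (oc_value X \<pi> (D n \<inter> K))) \<le> \<mu> (\<Union>n. D n)" if K: "compactin X K" for K
    proof -
      have "(\<Sum>n\<le>N. Fin (oc_value X \<pi> (D n \<inter> K))) \<le> Fin (oc_value X \<pi> ((\<Union>n. D n) \<inter> K))"
        by (rule isLub_upper[OF whole[OF K]]) blast
      also have "\<dots> \<le> \<mu> (\<Union>n. D n)"
        using K by (intro isLub_upper[OF \<mu>_Lub[OF UD]]) blast
      finally show ?thesis .
    qed
    then show "y \<le> \<mu> (\<Union>n. D n)"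
      unfolding y by (intro isLub_least[OF part]) blast
  next
    fix u assume u: "\<forall>y\<in>range (\<lambda>N. \<Sum>n\<le>N. \<mu> (D n)). y \<le> u"
    have "Fin (oc_value X \<pi> ((\<Union>n. D n) \<inter> K)) \<le> u" if K: "compactin X K" for K
    proof -
      have "(\<Sum>n\<le>N. Fin (oc_value X \<pi> (D n \<inter> K))) \<le> u" for N
      proof -
        have "(\<Sum>n\<le>N. Fin (oc_value X \<pi> (D n \<inter> K))) \<le> (\<Sum>n\<le>N. \<mu> (D n))"
          using K by (intro isLub_upper[OF part]) blast
        also have "\<dots> \<le> u"
          using u by blast
        finally show ?thesis .
      qed
      then show ?thesis
        by (intro isLub_least[OF whole[OF K]]) blast
    qed
    then show "\<mu> (\<Union>n. D n) \<le> u"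
      by (intro isLub_least[OF \<mu>_Lub[OF UD]]) blast
  qed
qed (rule \<mu>_nonneg)

lemma \<mu>_borel_ext_measure: "borel_ext_measure X \<mu>"
  unfolding borel_ext_measure_def using \<mu>_ext_measure by (simp add: \<mu>_bounded bounded_borel_compact)

lemma \<mu>_weakly_inner_regular:
  assumes "A \<in> sets (borel_of X)"
  shows "weakly_inner_regular_at X \<mu> A"
proof -
  have "{\<mu> (A \<inter> K) |K. compactin X K} = (\<lambda>K. Fin (oc_value X \<pi> (A \<inter> K))) ` {K. compactin X K}"
    unfolding setcompr_eq_image
    by (intro image_cong refl) (simp add: \<mu>_bounded bounded_borel_Int[OF assms])
  then show ?thesis
    using \<mu>_Lub[OF assms] by (simp add: weakly_inner_regular_at_def)
qed

subsection \<open>Representation of the operator\<close>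

text \<open>With the Riesz measures themselves as the scalar family, each functional sends both the
  order integral and \<open>\<pi> f\<close> to the Riesz integral of \<open>f\<close>; normality
  does the rest.\<close>

lemma \<mu>_order_nn_integral:
  assumes f: "f \<in> Cc X" "\<And>x. 0 \<le> f x"
  shows "order_nn_integral (borel_of X) \<mu> (\<lambda>x. ennreal (f x)) = Fin (\<pi> f)"
proof -
  obtain B where B: "\<And>x. \<bar>f x\<bar> \<le> B"
    using Cc_bounded[OF f(1)] by blast
  have fB: "f x \<le> B" for x
    using B[of x] by simp
  note K = Cc_compact_supp[OF f(1)]
  have b: "bounded_borel A" if "A \<in> sets (borel_of X)" "A \<subseteq> supp X f" for A
    by (rule bounded_borel_subset[OF bounded_borel_compact[OF K] that])
  obtain e where e: "order_nn_integral (borel_of X) \<mu> (\<lambda>x. ennreal (f x)) = Fin e"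
      "\<And>x'. x' \<in> positive_oc_functionals \<Longrightarrow> 0 \<le> x' e"
      "\<And>x'. x' \<in> positive_oc_functionals \<Longrightarrow> ennreal (x' e) = (\<integral>\<^sup>+x. ennreal (f x) \<partial>scalar x')"
  proof (rule order_nn_integral_functional[OF mc normal Cc_borel_measurable[OF f(1)] f(2) fB])
    show "\<mu> A = Fin (oc_value X \<pi> A) \<and> 0 \<le> oc_value X \<pi> A"
      if "A \<in> sets (borel_of X)" "A \<subseteq> supp X f" for A
      using b[OF that] by (simp add: \<mu>_bounded oc_value_nonneg)
    show "emeasure (scalar x') A = ennreal (x' (oc_value X \<pi> A))"
      if "x' \<in> positive_oc_functionals" "A \<in> sets (borel_of X)" "A \<subseteq> supp X f" for x' A
      using oc_value(2)[OF b[OF that(2,3)] that(1)] by simp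
  qed (auto intro: Cc_eq_0[OF f(1)] compactin_borel_of[OF K] simp: sets_scalar)
  have "e = \<pi> f"
  proof (rule normal_eqI[OF normal])
    fix x' :: "'e \<Rightarrow> real" assume x': "x' \<in> positive_oc_functionals"
    have "ennreal (x' e) = ennreal (x' (\<pi> f))"
      using e(3)[OF x'] riesz.riesz_representation[OF riesz_scalar[OF x'] f] by simp
    moreover have "0 \<le> x' (\<pi> f)"
      using f by (intro oc_functional_nonneg[OF x'] positive_operator_nonneg[OF positive])
    ultimately show "x' e = x' (\<pi> f)"
      using e(2)[OF x'] by simp
  qed
  with e(1) show ?thesis
    by simp
qed

lemma \<mu>_represents: "represents X \<mu> \<pi>"
  unfolding represents_def
proof (intro ballI conjI)
  fix f assume f: "f \<in> Cc X"
  show "order_integrable (borel_of X) \<mu> f"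
    using \<mu>_order_nn_integral[OF Cc_abs[OF f]] Cc_borel_measurable[OF f] by (simp add: order_integrable_def)
  have "\<pi> f = \<pi> (\<lambda>x. max (f x) 0 - max (- f x) 0)"
    by (rule arg_cong[of _ _ \<pi>]) auto
  also have "\<dots> = \<pi> (\<lambda>x. max (f x) 0) - \<pi> (\<lambda>x. max (- f x) 0)"
    by (intro positive_operator_diff[OF positive] Cc_pos_part Cc_minus f)
  finally show "\<pi> f = order_integral (borel_of X) \<mu> f"
    using \<mu>_order_nn_integral[OF Cc_pos_part[OF f]] \<mu>_order_nn_integral[OF Cc_pos_part[OF Cc_minus[OF f]]]
    by (simp add: order_integral_def)
qed

text \<open>Turns the representation by an arbitrary Borel measure \<open>\<nu>\<close> into a
  scalar integral formula, without yet knowing that \<open>\<nu>\<close> is related to a Riesz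
  measure. The measure \<open>N\<close> may depend on \<open>f\<close>, as it need only describe
  \<open>\<nu>\<close> on the support of \<open>f\<close>.\<close>

lemma represents_scalar:
  assumes \<nu>: "borel_ext_measure X \<nu>" "represents X \<nu> \<pi>"
    and f: "f \<in> Cc X" "\<And>x. 0 \<le> f x" and x': "x' \<in> positive_oc_functionals"
  obtains N where "sets N = sets (borel_of X)"
    "\<And>A. A \<in> sets (borel_of X) \<Longrightarrow> A \<subseteq> supp X f \<Longrightarrow> emeasure N A = ennreal (x' (fin_part (\<nu> A)))"
    "ennreal (x' (\<pi> f)) = (\<integral>\<^sup>+x. ennreal (f x) \<partial>N)"
proof -
  note K = Cc_compact_supp[OF f(1)]
  have m: "ext_measure (borel_of X) \<nu>" and fin: "is_finite (\<nu> (supp X f))"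
    using \<nu>(1) K by (auto simp: borel_ext_measure_def)
  have "\<forall>y'\<in>positive_oc_functionals. \<exists>N. sets N = sets (borel_of X) \<and>
      (\<forall>A\<in>sets (borel_of X). A \<subseteq> supp X f \<longrightarrow> emeasure N A = ennreal (y' (fin_part (\<nu> A))))"
  proof
    fix y' :: "'e \<Rightarrow> real" assume y': "y' \<in> positive_oc_functionals"
    show "\<exists>N. sets N = sets (borel_of X) \<and>
      (\<forall>A\<in>sets (borel_of X). A \<subseteq> supp X f \<longrightarrow> emeasure N A = ennreal (y' (fin_part (\<nu> A))))"
      by (rule ext_measure_functional[OF m compactin_borel_of[OF K] fin y']) blast
  qed
  from bchoice[OF this] obtain N where N: "\<And>y'. y' \<in> positive_oc_functionals \<Longrightarrow> sets (N y') = sets (borel_of X)"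
      "\<And>y' A. y' \<in> positive_oc_functionals \<Longrightarrow> A \<in> sets (borel_of X) \<Longrightarrow> A \<subseteq> supp X f \<Longrightarrow>
        emeasure (N y') A = ennreal (y' (fin_part (\<nu> A)))"
    by blast
  have \<nu>fin: "\<nu> A = Fin (fin_part (\<nu> A)) \<and> 0 \<le> fin_part (\<nu> A)"
    if A: "A \<in> sets (borel_of X)" "A \<subseteq> supp X f" for A
  proof -
    have "is_finite (\<nu> A)"
      using ext_measure_mono[OF m A(1) compactin_borel_of[OF K] A(2)] fin by (rule is_finite_le)
    then show ?thesis
      using ext_measure_nonneg[OF m A(1)] by (simp add: Fin_fin_part fin_part_nonneg)
  qed
  have integral: "\<exists>e. order_nn_integral (borel_of X) \<nu> (\<lambda>x. ennreal (h x)) = Fin e \<and>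
      (\<forall>y'\<in>positive_oc_functionals. 0 \<le> y' e \<and> ennreal (y' e) = (\<integral>\<^sup>+x. ennreal (h x) \<partial>N y'))"
    if h: "h \<in> Cc X" "\<And>x. 0 \<le> h x" "supp X h \<subseteq> supp X f" for h
  proof -
    obtain B where B: "\<And>x. \<bar>h x\<bar> \<le> B"
      using Cc_bounded[OF h(1)] by blast
    have hB: "h x \<le> B" for x
      using B[of x] by simp
    have h0: "h x = 0" if "x \<notin> supp X f" for x
      using that h(3) Cc_eq_0[OF h(1)] by blast
    show ?thesis
      by (rule order_nn_integral_functional[where v = "\<lambda>A. fin_part (\<nu> A)" and N = N and \<nu> = \<nu>,
            OF mc normal Cc_borel_measurable[OF h(1)] h(2) hB h0 compactin_borel_of[OF K] \<nu>fin N]) blast+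
  qed
  obtain e where e: "order_nn_integral (borel_of X) \<nu> (\<lambda>x. ennreal (f x)) = Fin e"
      "\<And>y'. y' \<in> positive_oc_functionals \<Longrightarrow> ennreal (y' e) = (\<integral>\<^sup>+x. ennreal (f x) \<partial>N y')"
    using integral[OF f] by blast
  \<comment> \<open>The order integral of \<open>f\<close> subtracts the integral of its negative
    part, here the zero function. That integral is given by a description, so its value 0 has to be
    derived like any other.\<close>
  obtain d where d: "order_nn_integral (borel_of X) \<nu> (\<lambda>x. ennreal 0) = Fin d"
      "\<And>y'. y' \<in> positive_oc_functionals \<Longrightarrow> 0 \<le> y' d \<and> ennreal (y' d) = 0"
    using integral[of "\<lambda>x. 0"] by (auto simp: Cc_0)
  have "d = 0"
  proof (rule normal_eqI[OF normal])
    fix y' :: "'e \<Rightarrow> real" assume y': "y' \<in> positive_oc_functionals"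
    show "y' d = y' 0"
      using d(2)[OF y'] linear_0[OF oc_functional_linear[OF y']] by (simp add: ennreal_eq_0_iff)
  qed
  moreover have "max (f x) 0 = f x" "max (- f x) 0 = 0" for x
    using f(2)[of x] by simp_all
  ultimately have "\<pi> f = e"
    using \<nu>(2) f(1) e(1) d(1) by (simp add: represents_def order_integral_def)
  then show thesis
    using that[OF N(1,2)[OF x']] e(2)[OF x'] by simp
qed

lemma represents_le:
  assumes \<nu>: "borel_ext_measure X \<nu>" "represents X \<nu> \<pi>" and f: "f \<in> Cc_below X V"
  shows "Fin (\<pi> f) \<le> \<nu> (supp X f)"
proof -
  note f' = Cc_belowD[OF f]
  note K = Cc_compact_supp[OF f'(1)]
  have m: "ext_measure (borel_of X) \<nu>" and fin: "is_finite (\<nu> (supp X f))"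
    using \<nu>(1) K by (auto simp: borel_ext_measure_def)
  have nonneg: "0 \<le> fin_part (\<nu> (supp X f))"
    by (intro fin_part_nonneg fin ext_measure_nonneg[OF m compactin_borel_of[OF K]])
  have "\<pi> f \<le> fin_part (\<nu> (supp X f))"
  proof (rule scalar_le_imp_le)
    fix x' :: "'e \<Rightarrow> real" assume x': "x' \<in> positive_oc_functionals"
    obtain N where N: "sets N = sets (borel_of X)"
        "\<And>A. A \<in> sets (borel_of X) \<Longrightarrow> A \<subseteq> supp X f \<Longrightarrow> emeasure N A = ennreal (x' (fin_part (\<nu> A)))"
        "ennreal (x' (\<pi> f)) = (\<integral>\<^sup>+x. ennreal (f x) \<partial>N)"
      using represents_scalar[OF \<nu> f'(1,2) x'] by blast
    have "(\<integral>\<^sup>+x. ennreal (f x) \<partial>N) \<le> (\<integral>\<^sup>+x. indicator (supp X f) x \<partial>N)"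
      using f'(3) Cc_eq_0[OF f'(1)] by (intro nn_integral_mono) (auto simp: indicator_def)
    also have "\<dots> = ennreal (x' (fin_part (\<nu> (supp X f))))"
      using N(1,2) compactin_borel_of[OF K] by simp
    finally show "ennreal (x' (\<pi> f)) \<le> ennreal (x' (fin_part (\<nu> (supp X f))))"
      by (simp add: N(3))
    show "0 \<le> x' (fin_part (\<nu> (supp X f)))"
      by (rule oc_functional_nonneg[OF x' nonneg])
  qed
  then have "Fin (\<pi> f) \<le> Fin (fin_part (\<nu> (supp X f)))"
    by simp
  then show ?thesis
    by (simp add: Fin_fin_part[OF fin])
qed

lemma represents_ge:
  assumes \<nu>: "borel_ext_measure X \<nu>" "represents X \<nu> \<pi>"
    and f: "f \<in> Cc X" "\<And>x. 0 \<le> f x" and K: "compactin X K" "\<And>x. x \<in> K \<Longrightarrow> 1 \<le> f x"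
  shows "\<nu> K \<le> Fin (\<pi> f)"
proof -
  have "f x \<noteq> 0" if "x \<in> K" for x
    using K(2)[OF that] by auto
  then have Kf: "K \<subseteq> supp X f"
    using Cc_eq_0[OF f(1)] by blast
  have fin: "is_finite (\<nu> K)"
    using \<nu>(1) K by (auto simp: borel_ext_measure_def)
  have "fin_part (\<nu> K) \<le> \<pi> f"
  proof (rule scalar_le_imp_le)
    fix x' :: "'e \<Rightarrow> real" assume x': "x' \<in> positive_oc_functionals"
    obtain N where N: "sets N = sets (borel_of X)"
        "\<And>A. A \<in> sets (borel_of X) \<Longrightarrow> A \<subseteq> supp X f \<Longrightarrow> emeasure N A = ennreal (x' (fin_part (\<nu> A)))"
        "ennreal (x' (\<pi> f)) = (\<integral>\<^sup>+x. ennreal (f x) \<partial>N)"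
      using represents_scalar[OF \<nu> f x'] by blast
    have "ennreal (x' (fin_part (\<nu> K))) = (\<integral>\<^sup>+x. indicator K x \<partial>N)"
      using N(1,2) compactin_borel_of[OF K(1)] Kf by simp
    also have "\<dots> \<le> (\<integral>\<^sup>+x. ennreal (f x) \<partial>N)"
      using K(2) by (intro nn_integral_mono) (auto simp: indicator_def)
    finally show "ennreal (x' (fin_part (\<nu> K))) \<le> ennreal (x' (\<pi> f))"
      by (simp add: N(3))
    show "0 \<le> x' (\<pi> f)"
      using f by (intro oc_functional_nonneg[OF x'] positive_operator_nonneg[OF positive])
  qed
  then have "Fin (fin_part (\<nu> K)) \<le> Fin (\<pi> f)"
    by simp
  then show ?thesis
    by (simp add: Fin_fin_part[OF fin])
qed

text \<open>The values of \<open>\<pi>\<close> interlace with those of \<open>\<nu>\<close>: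
  \<open>\<pi> f\<close> is at most \<open>\<nu>\<close> of the support of \<open>f\<close>, and
  every compact \<open>K \<subseteq> V\<close> admits a cutoff \<open>f\<close> with
  \<open>\<nu> K \<le> Fin (\<pi> f)\<close>. As the supremum mentions only \<open>\<pi>\<close>,
  two such measures agree at \<open>V\<close>.\<close>

lemma represents_open_Lub:
  assumes \<nu>: "borel_ext_measure X \<nu>" "represents X \<nu> \<pi>"
    and V: "openin X V" "inner_regular_at X \<nu> V"
  shows "isLub UNIV ((\<lambda>f. Fin (\<pi> f)) ` Cc_below X V) (\<nu> V)"
  unfolding isLub_iff
proof (intro conjI ballI allI impI)
  fix y assume "y \<in> (\<lambda>f. Fin (\<pi> f)) ` Cc_below X V"
  then obtain f where f: "f \<in> Cc_below X V" "y = Fin (\<pi> f)"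
    by blast
  have "y \<le> \<nu> (supp X f)"
    unfolding f(2) by (rule represents_le[OF \<nu> f(1)])
  also have "\<dots> \<le> \<nu> V"
    using \<nu>(1) Cc_belowD[OF f(1)] compactin_borel_of[OF Cc_compact_supp] V(1)
    by (intro ext_measure_mono[of "borel_of X"]) (auto simp: borel_ext_measure_def openin_borel_of)
  finally show "y \<le> \<nu> V" .
next
  fix u assume u: "\<forall>y\<in>(\<lambda>f. Fin (\<pi> f)) ` Cc_below X V. y \<le> u"
  have "\<nu> K \<le> u" if K: "compactin X K" "K \<subseteq> V" for K
  proof -
    obtain f N where f: "f \<in> Cc_below X V" "K \<subseteq> N" "\<And>x. x \<in> N \<Longrightarrow> f x = 1"
      by (rule cutoff_function[OF K(1) V(1) K(2)]) blast
    have "\<nu> K \<le> Fin (\<pi> f)"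
      using f Cc_belowD[OF f(1)] by (intro represents_ge[OF \<nu> _ _ K(1)]) auto
    also have "\<dots> \<le> u"
      using u f(1) by blast
    finally show ?thesis .
  qed
  then show "\<nu> V \<le> u"
    using isLub_least[OF V(2)[unfolded inner_regular_at_def], of u] by blast
qed

subsection \<open>Regularity\<close>

text \<open>The supports of functions below \<open>V\<close> are already enough compact sets: a
  bound for their measures bounds every \<open>\<pi> f\<close>, and under each functional the values
  \<open>\<pi> f\<close> have the image of the vector of \<open>V\<close> as supremum.\<close>

lemma \<mu>_inner_regular_bounded:
  assumes V: "relatively_compact_open X V"
  shows "inner_regular_at X \<mu> V"
  unfolding inner_regular_at_def isLub_iff
proof (intro conjI ballI allI impI)
  have opV: "openin X V" and bV: "bounded_borel V"
    using V by (simp_all add: relatively_compact_open_def bounded_borel_relatively_compact_open)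
  show "y \<le> \<mu> V" if "y \<in> {\<mu> K |K. compactin X K \<and> K \<subseteq> V}" for y
    using that openin_borel_of[OF opV] by (auto intro!: ext_measure_mono[OF \<mu>_ext_measure] compactin_borel_of)
  fix u assume u: "\<forall>y\<in>{\<mu> K |K. compactin X K \<and> K \<subseteq> V}. y \<le> u"
  have le: "Fin (\<pi> f) \<le> u" if f: "f \<in> Cc_below X V" for f
  proof -
    have "Fin (\<pi> f) \<le> \<mu> (supp X f)"
      by (rule represents_le[OF \<mu>_borel_ext_measure \<mu>_represents f])
    also have "\<dots> \<le> u"
      using u Cc_compact_supp[OF Cc_belowD(1)[OF f]] Cc_belowD(4)[OF f] by blast
    finally show ?thesis .
  qed
  show "\<mu> V \<le> u"
  proof (cases u)
    case (Fin a)
    have "oc_value X \<pi> V \<le> a"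
      unfolding normal_le_iff[OF normal]
    proof
      fix x' :: "'e \<Rightarrow> real" assume x': "x' \<in> positive_oc_functionals"
      have a: "x' (\<pi> f) \<le> x' a" if "f \<in> Cc_below X V" for f
        using le[OF that] Fin by (intro oc_functional_mono[OF x']) simp
      \<comment> \<open>The zero function is below \<open>V\<close>; this sign is what allows the
        final comparison in \<open>ennreal\<close> to be read in the reals.\<close>
      have "0 \<le> x' a"
        using a[OF Cc_below_0] positive_operator_0[OF positive] linear_0[OF oc_functional_linear[OF x']] by simp
      moreover have "ennreal (x' (oc_value X \<pi> V)) \<le> ennreal (x' a)"
        unfolding oc_value(2)[OF bV x'] riesz.emeasure_riesz_open[OF riesz_scalar[OF x'] opV]
        by (intro SUP_least ennreal_leI a)
      ultimately show "x' (oc_value X \<pi> V) \<le> x' a"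
        by simp
    qed
    then show ?thesis
      by (simp add: \<mu>_bounded[OF bV] Fin)
  qed simp
qed

text \<open>Weak inner regularity reduces \<open>V\<close> to the pieces
  \<open>V \<inter> K\<close>. These need not be open, so each is enlarged to
  \<open>V \<inter> U\<close> with \<open>U\<close> a relatively compact neighbourhood of
  \<open>K\<close>, where the bounded case applies.\<close>

lemma \<mu>_inner_regular:
  assumes V: "openin X V"
  shows "inner_regular_at X \<mu> V"
  unfolding inner_regular_at_def isLub_iff
proof (intro conjI ballI allI impI)
  show "y \<le> \<mu> V" if "y \<in> {\<mu> K |K. compactin X K \<and> K \<subseteq> V}" for y
    using that openin_borel_of[OF V] by (auto intro!: ext_measure_mono[OF \<mu>_ext_measure] compactin_borel_of)
  fix u assume u: "\<forall>y\<in>{\<mu> K |K. compactin X K \<and> K \<subseteq> V}. y \<le> u"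
  have "\<mu> (V \<inter> K) \<le> u" if K: "compactin X K" for K
  proof -
    obtain U where U: "relatively_compact_open X U" "K \<subseteq> U"
      using bounded_borel_neighbourhood[OF bounded_borel_compact[OF K]] .
    have opU: "openin X U"
      using U(1) by (simp add: relatively_compact_open_def)
    have "relatively_compact_open X (V \<inter> U)"
      using V opU bounded_borel_subset[OF bounded_borel_relatively_compact_open[OF U(1)]]
      by (auto intro!: bounded_borel_open openin_borel_of)
    from \<mu>_inner_regular_bounded[OF this, unfolded inner_regular_at_def] have "\<mu> (V \<inter> U) \<le> u"
      using u by (elim isLub_least) blast
    moreover have "\<mu> (V \<inter> K) \<le> \<mu> (V \<inter> U)"
      using U(2) openin_borel_of[OF V] openin_borel_of[OF opU] compactin_borel_of[OF K]
      by (intro ext_measure_mono[OF \<mu>_ext_measure]) auto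
    ultimately show ?thesis
      by (rule order_trans[rotated])
  qed
  then show "\<mu> V \<le> u"
    using isLub_least[OF \<mu>_weakly_inner_regular[OF openin_borel_of[OF V], unfolded weakly_inner_regular_at_def], of u]
    by blast
qed

lemma \<mu>_regular_bounded:
  assumes U: "relatively_compact_open X U"
  shows "regular_borel_measure (subtopology X U) \<mu>"
  unfolding regular_borel_measure_def
proof (intro conjI allI impI ballI)
  have opU: "openin X U"
    using U by (simp add: relatively_compact_open_def)
  show "borel_ext_measure (subtopology X U) \<mu>"
    by (rule borel_ext_measure_subtopology[OF \<mu>_borel_ext_measure opU])
  show "inner_regular_at (subtopology X U) \<mu> V" if "openin (subtopology X U) V" for V
    using that opU by (simp add: inner_regular_at_subtopology openin_open_subtopology \<mu>_inner_regular)
  fix A assume "A \<in> sets (borel_of (subtopology X U))"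
  then have A: "A \<in> sets (borel_of X)" "A \<subseteq> U"
    by (simp_all add: sets_borel_of_open_subtopology[OF opU])
  let ?V = "{V. openin X V \<and> V \<subseteq> U \<and> A \<subseteq> V}"
  have b: "bounded_borel B" if "B \<in> sets (borel_of X)" "B \<subseteq> U" for B
    by (rule bounded_borel_subset[OF bounded_borel_relatively_compact_open[OF U] that])
  have "{\<mu> V |V. openin X V \<and> V \<subseteq> U \<and> A \<subseteq> V} = Fin ` oc_value X \<pi> ` ?V"
    unfolding setcompr_eq_image image_image by (intro image_cong refl) (auto simp: \<mu>_bounded b openin_borel_of)
  moreover have "isGlb UNIV (Fin ` oc_value X \<pi> ` ?V) (Fin (oc_value X \<pi> A))"
    using opU A(2) by (intro isGlb_Fin_image oc_value_outer_regular[OF A(1) U A(2)]) blast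
  ultimately show "outer_regular_at (subtopology X U) \<mu> A"
    by (simp add: outer_regular_at_subtopology[OF opU] \<mu>_bounded b A)
qed

lemma \<mu>_is_representing: "is_representing_measure X \<pi> \<mu>"
  by (simp add: is_representing_measure_def \<mu>_ext_measure \<mu>_regular_bounded \<mu>_weakly_inner_regular \<mu>_represents)

lemma \<mu>_quasi_regular: "quasi_regular_borel_measure X \<mu>"
  by (simp add: quasi_regular_borel_measure_def \<mu>_borel_ext_measure \<mu>_inner_regular \<mu>_weakly_inner_regular)

subsection \<open>Uniqueness and comparison\<close>

text \<open>Inside a relatively compact \<open>U\<close>, inner regularity fixes the open sets
  through \<open>\<pi>\<close> and outer regularity fixes the rest. Assuming only local regularity
  lets the lemma serve both for uniqueness and for measures regular on all of
  \<open>X\<close>.\<close>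

lemma \<mu>_unique_bounded:
  assumes \<nu>: "borel_ext_measure X \<nu>" "represents X \<nu> \<pi>"
    and reg: "\<And>U. relatively_compact_open X U \<Longrightarrow> regular_borel_measure (subtopology X U) \<nu>"
    and A: "bounded_borel A"
  shows "\<nu> A = \<mu> A"
proof -
  obtain U where U: "relatively_compact_open X U" "A \<subseteq> U"
    using bounded_borel_neighbourhood[OF A] .
  have opU: "openin X U"
    using U(1) by (simp add: relatively_compact_open_def)
  have A': "A \<in> sets (borel_of (subtopology X U))"
    using A U(2) by (simp add: sets_borel_of_open_subtopology[OF opU] bounded_borel_def)
  have inner: "inner_regular_at X \<nu> V" if "openin X V" "V \<subseteq> U" for V
    using reg[OF U(1)] opU that
    by (simp add: regular_borel_measure_def openin_open_subtopology inner_regular_at_subtopology)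
  have "\<nu> V = \<mu> V" if V: "openin X V" "V \<subseteq> U" for V
    using represents_open_Lub[OF \<nu> V(1) inner[OF V]]
      represents_open_Lub[OF \<mu>_borel_ext_measure \<mu>_represents V(1) \<mu>_inner_regular[OF V(1)]]
    by (rule isLub_eqI)
  then have eq: "{\<nu> V |V. openin X V \<and> V \<subseteq> U \<and> A \<subseteq> V} = {\<mu> V |V. openin X V \<and> V \<subseteq> U \<and> A \<subseteq> V}"
    unfolding setcompr_eq_image by (intro image_cong) auto
  have "isGlb UNIV {\<nu> V |V. openin X V \<and> V \<subseteq> U \<and> A \<subseteq> V} (\<nu> A)"
    using reg[OF U(1)] A' by (simp add: regular_borel_measure_def outer_regular_at_subtopology[OF opU])
  then have "isGlb UNIV {\<mu> V |V. openin X V \<and> V \<subseteq> U \<and> A \<subseteq> V} (\<nu> A)"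
    unfolding eq .
  moreover have "isGlb UNIV {\<mu> V |V. openin X V \<and> V \<subseteq> U \<and> A \<subseteq> V} (\<mu> A)"
    using \<mu>_regular_bounded[OF U(1)] A' by (simp add: regular_borel_measure_def outer_regular_at_subtopology[OF opU])
  ultimately show ?thesis
    by (rule isGlb_eqI)
qed

lemma is_representing_borel_ext_measure:
  assumes "is_representing_measure X \<pi> \<nu>"
  shows "borel_ext_measure X \<nu>"
  unfolding borel_ext_measure_def
proof (intro conjI allI impI)
  show "ext_measure (borel_of X) \<nu>"
    using assms by (simp add: is_representing_measure_def)
  fix K assume K: "compactin X K"
  obtain U where U: "relatively_compact_open X U" "K \<subseteq> U"
    using bounded_borel_neighbourhood[OF bounded_borel_compact[OF K]] .
  then have "borel_ext_measure (subtopology X U) \<nu>"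
    using assms by (simp add: is_representing_measure_def regular_borel_measure_def)
  then show "is_finite (\<nu> K)"
    using K U(2) by (simp add: borel_ext_measure_def compactin_subtopology)
qed

text \<open>Weak inner regularity of both measures extends their agreement from the sets
  \<open>A \<inter> K\<close> to \<open>A\<close>.\<close>

lemma \<mu>_unique:
  assumes \<nu>: "is_representing_measure X \<pi> \<nu>" and A: "A \<in> sets (borel_of X)"
  shows "\<nu> A = \<mu> A"
proof -
  have "\<nu> (A \<inter> K) = \<mu> (A \<inter> K)" if "compactin X K" for K
    using \<nu> that by (intro \<mu>_unique_bounded is_representing_borel_ext_measure bounded_borel_Int A)
      (auto simp: is_representing_measure_def)
  then have eq: "{\<nu> (A \<inter> K) |K. compactin X K} = {\<mu> (A \<inter> K) |K. compactin X K}"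
    unfolding setcompr_eq_image by (intro image_cong) auto
  have "isLub UNIV {\<nu> (A \<inter> K) |K. compactin X K} (\<nu> A)"
    using \<nu> A by (simp add: is_representing_measure_def weakly_inner_regular_at_def)
  then have "isLub UNIV {\<mu> (A \<inter> K) |K. compactin X K} (\<nu> A)"
    unfolding eq .
  moreover have "isLub UNIV {\<mu> (A \<inter> K) |K. compactin X K} (\<mu> A)"
    using \<mu>_weakly_inner_regular[OF A] by (simp add: weakly_inner_regular_at_def)
  ultimately show ?thesis
    by (rule isLub_eqI)
qed

context
  fixes \<nu> :: "'a set \<Rightarrow> 'e ext_space"
  assumes regular: "regular_borel_measure X \<nu>" and represents: "represents X \<nu> \<pi>"
begin

lemma regular_borel_ext_measure: "borel_ext_measure X \<nu>"
  using regular by (simp add: regular_borel_measure_def)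

lemma regular_ext_measure: "ext_measure (borel_of X) \<nu>"
  using regular_borel_ext_measure by (simp add: borel_ext_measure_def)

lemma regular_eq_bounded: "bounded_borel A \<Longrightarrow> \<nu> A = \<mu> A"
  by (rule \<mu>_unique_bounded[OF regular_borel_ext_measure represents])
    (auto intro: regular_borel_measure_subtopology[OF regular] simp: relatively_compact_open_def)

lemma regular_eq_open:
  assumes V: "openin X V"
  shows "\<nu> V = \<mu> V"
proof -
  have "inner_regular_at X \<nu> V"
    using regular V by (simp add: regular_borel_measure_def)
  from represents_open_Lub[OF regular_borel_ext_measure represents V this]
    represents_open_Lub[OF \<mu>_borel_ext_measure \<mu>_represents V \<mu>_inner_regular[OF V]]
  show ?thesis
    by (rule isLub_eqI)
qed

text \<open>Only one of the two measures is known to be a supremum over the pieces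
  \<open>A \<inter> K\<close>, on which both agree; for the other, monotonicity leaves just an
  inequality.\<close>

lemma \<mu>_le_regular:
  assumes A: "A \<in> sets (borel_of X)"
  shows "\<mu> A \<le> \<nu> A"
proof -
  have "\<mu> (A \<inter> K) \<le> \<nu> A" if K: "compactin X K" for K
    unfolding regular_eq_bounded[OF bounded_borel_Int[OF A K], symmetric]
    using A compactin_borel_of[OF K] by (intro ext_measure_mono[OF regular_ext_measure]) auto
  then show ?thesis
    using isLub_least[OF \<mu>_weakly_inner_regular[OF A, unfolded weakly_inner_regular_at_def], of "\<nu> A"] by blast
qed

text \<open>
  An open set \<open>V \<supseteq> A\<close> of finite measure exists by outer regularity. There the measures agree,
  while \<open>\<mu> \<le> \<nu>\<close> on both \<open>A\<close> and \<open>V - A\<close>.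
\<close>

lemma regular_eq_finite:
  assumes A: "A \<in> sets (borel_of X)" and fin: "is_finite (\<nu> A)"
  shows "\<nu> A = \<mu> A"
proof -
  have glb: "isGlb UNIV {\<nu> V |V. openin X V \<and> A \<subseteq> V} (\<nu> A)"
    using regular A by (simp add: regular_borel_measure_def outer_regular_at_def)
  have "\<exists>V. openin X V \<and> A \<subseteq> V \<and> is_finite (\<nu> V)"
  proof (rule ccontr)
    assume "\<not> ?thesis"
    then have "\<forall>y\<in>{\<nu> V |V. openin X V \<and> A \<subseteq> V}. Infty \<le> y"
      by (auto simp: is_finite_def)
    then have "Infty \<le> \<nu> A"
      by (intro isGlb_greatest[OF glb]) blast
    with fin show False
      by (cases "\<nu> A") auto
  qed
  then obtain V where V: "openin X V" "A \<subseteq> V" "is_finite (\<nu> V)"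
    by blast
  have VA: "V - A \<in> sets (borel_of X)"
    using A openin_borel_of[OF V(1)] by blast
  have "\<nu> V = \<nu> (A \<union> (V - A))" "\<mu> V = \<mu> (A \<union> (V - A))"
    using V(2) by (simp_all add: Un_absorb1)
  then have "\<nu> V = \<nu> A + \<nu> (V - A)" "\<mu> V = \<mu> A + \<mu> (V - A)"
    using ext_measure_Un[OF regular_ext_measure A VA] ext_measure_Un[OF \<mu>_ext_measure A VA] by auto
  then have eq: "\<nu> A + \<nu> (V - A) = \<mu> A + \<mu> (V - A)" "is_finite (\<nu> A + \<nu> (V - A))"
    using regular_eq_open[OF V(1)] V(3) by auto
  have le: "\<mu> A \<le> \<nu> A" "\<mu> (V - A) \<le> \<nu> (V - A)"
    by (intro \<mu>_le_regular A VA)+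
  have "\<nu> A \<le> \<mu> A"
  \<comment> \<open>Finiteness of the common sum leaves only the case of four finite values, and
    there \<open>d \<le> b\<close> allows cancellation in the equation
    \<open>a + b = c + d\<close>.\<close>
  proof (cases "\<nu> A"; cases "\<nu> (V - A)"; cases "\<mu> A"; cases "\<mu> (V - A)")
    fix a b c d assume *: "\<nu> A = Fin a" "\<nu> (V - A) = Fin b" "\<mu> A = Fin c" "\<mu> (V - A) = Fin d"
    then have "a + b = c + d" "d \<le> b"
      using eq le by auto
    then have "a \<le> c"
      by (metis add_le_cancel_right add_left_mono)
    with * show ?thesis
      by simp
  qed (use eq le in auto)
  with le(1) show ?thesis
    by (rule order_antisym[rotated])
qed

lemma regular_eq_infinite:
  assumes "A \<in> sets (borel_of X)" "\<not> is_finite (\<mu> A)"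
  shows "\<nu> A = \<mu> A"
  using \<mu>_le_regular[OF assms(1)] assms(2) by (cases "\<nu> A") (auto simp: is_finite_def dest: is_finite_le)

end

end

theorem theorem5p6:
  fixes X :: "'a topology"
    and \<pi> :: "('a \<Rightarrow> real) \<Rightarrow> 'e::ordered_real_vector"
  assumes "locally_compact_space X" and "Hausdorff_space X"
    and "monotone_complete TYPE('e)" and "normal_ordered_space TYPE('e)"
    and "positive_operator_Cc X \<pi>"
  shows "\<exists>\<mu> :: 'a set \<Rightarrow> 'e ext_space.
    is_representing_measure X \<pi> \<mu> \<and>
    (\<forall>\<nu>. is_representing_measure X \<pi> \<nu> \<longrightarrow> (\<forall>\<Delta>\<in>sets (borel_of X). \<nu> \<Delta> = \<mu> \<Delta>)) \<and>
    quasi_regular_borel_measure X \<mu> \<and>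
    (\<forall>\<mu>'. regular_borel_measure X \<mu>' \<and> represents X \<mu>' \<pi> \<longrightarrow>
       (\<forall>\<Delta>\<in>sets (borel_of X). \<mu> \<Delta> \<le> \<mu>' \<Delta>) \<and>
       (\<forall>V. openin X V \<longrightarrow> \<mu>' V = \<mu> V) \<and>
       (\<forall>K. compactin X K \<longrightarrow> \<mu>' K = \<mu> K) \<and>
       (\<forall>\<Delta>\<in>sets (borel_of X). is_finite (\<mu>' \<Delta>) \<longrightarrow> \<mu>' \<Delta> = \<mu> \<Delta>) \<and>
       (\<forall>\<Delta>\<in>sets (borel_of X). \<not> is_finite (\<mu> \<Delta>) \<longrightarrow> \<mu>' \<Delta> = \<mu> \<Delta>))"
proof -
  interpret normal_riesz X \<pi>
    using assms by unfold_locales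
  show ?thesis
  proof (intro exI[of _ "representing_measure X \<pi>"] conjI allI impI ballI)
    show "is_representing_measure X \<pi> (representing_measure X \<pi>)"
      by (rule \<mu>_is_representing)
    show "quasi_regular_borel_measure X (representing_measure X \<pi>)"
      by (rule \<mu>_quasi_regular)
  qed (auto intro: \<mu>_unique \<mu>_le_regular regular_eq_open regular_eq_bounded bounded_borel_compact
      regular_eq_finite regular_eq_infinite)
qed

end
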